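(* Let $u(x,t)$ be the soliton gas solution of the KdV equation determined by $0<\eta_1<\eta_2$ and $r$ (defined in the context), and let $\xi=\frac{x}{4t}$. For every fixed $\xi>\eta_2^2$ there is a positive constant $C=C(\xi)$ such that $$u(x,t)=\mathcal{O}\!\left(e^{-Ct}\right)\qquad\text{as } t\to+\infty,\ x=4\xi t.$$
   Context: Let $0<\eta_1<\eta_2$, $\Sigma_1=(\eta_1,\eta_2)$, $\Sigma_2=(-\eta_2,-\eta_1)$, both oriented from left to right; subscripts $\pm$ denote boundary values from the upper/lower half plane. Let $r$ be analytic in a neighbourhood of $[\eta_1,\eta_2]\cup[-\eta_2,-\eta_1]$, real, positive and non-vanishing on these intervals, with $r(-\lambda)=r(\lambda)$. For $x\in\mathbb{R}$, $t\ge 0$ let $Y(\lambda)=Y(\lambda;x,t)=[Y_1,Y_2]$ be the (unique) row-vector function, analytic in $\mathbb{C}\setminus(\overline{\Sigma_1}\cup\overline{\Sigma_2})$, with at most logarithmic singularities at $\pm\eta_1,\pm\eta_2$, such that $Y_+=Y_-\begin{bmatrix}1&0\\-ir(\lambda)e^{8\lambda^3t-2\lambda x}&1\end{bmatrix}$ on $\Sigma_1$, $Y_+=Y_-\begin{bmatrix}1&ir(\lambda)e^{-8\lambda^3t+2\lambda x}\\0&1\end{bmatrix}$ on $\Sigma_2$, $Y(\lambda)=[1\;\;1]+\mathcal{O}(1/\lambda)$ as $\lambda\to\infty$, and $Y(-\lambda)=Y(\lambda)\begin{bmatrix}0&1\\1&0\end{bmatrix}$. The soliton gas solution of the KdV equation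 $u_t-6uu_x+u_{xxx}=0$ is $u(x,t)=2\frac{\partial}{\partial x}\left[\lim_{\lambda\to\infty}\lambda(Y_1(\lambda;x,t)-1)\right]$. *)

theory Defs
  imports "HOL-Complex_Analysis.Complex_Analysis" "HOL-Library.Landau_Symbols"
begin

definition Sigma1 :: "real \<Rightarrow> real \<Rightarrow> complex set" where
  "Sigma1 \<eta>1 \<eta>2 = complex_of_real ` {\<eta>1<..<\<eta>2}"

definition Sigma2 :: "real \<Rightarrow> real \<Rightarrow> complex set" where
  "Sigma2 \<eta>1 \<eta>2 = complex_of_real ` {-\<eta>2<..<-\<eta>1}"

abbreviation contour :: "real \<Rightarrow> real \<Rightarrow> complex set" where
  "contour \<eta>1 \<eta>2 \<equiv> closure (Sigma1 \<eta>1 \<eta>2) \<union> closure (Sigma2 \<eta>1 \<eta>2)"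

text \<open>\<^const>\<open>analytic_on\<close> already means holomorphic on an open neighbourhood of the set. The
  evenness of \<open>r\<close> is required on the intervals only; by the identity theorem it then holds on a
  symmetric neighbourhood.\<close>

definition admissible_reflection :: "real \<Rightarrow> real \<Rightarrow> (complex \<Rightarrow> complex) \<Rightarrow> bool" where
  "admissible_reflection \<eta>1 \<eta>2 r \<longleftrightarrow>
     r analytic_on contour \<eta>1 \<eta>2 \<and>
     (\<forall>z \<in> contour \<eta>1 \<eta>2. r z \<in> \<real> \<and> 0 < Re (r z)) \<and>
     (\<forall>z \<in> contour \<eta>1 \<eta>2. r (- z) = r z)"

definition jump1 :: "(complex \<Rightarrow> complex) \<Rightarrow> real \<Rightarrow> real \<Rightarrow> complex \<Rightarrow> complex^2^2" where
  "jump1 r x t z =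
     vector [vector [1, 0],
             vector [- \<i> * r z * exp (8 * z^3 * of_real t - 2 * z * of_real x), 1]]"

definition jump2 :: "(complex \<Rightarrow> complex) \<Rightarrow> real \<Rightarrow> real \<Rightarrow> complex \<Rightarrow> complex^2^2" where
  "jump2 r x t z =
     vector [vector [1, \<i> * r z * exp (- 8 * z^3 * of_real t + 2 * z * of_real x)],
             vector [0, 1]]"

text \<open>\<open>Y\<^sub>+ = Y\<^sub>- J\<close> at the real point \<open>z\<close>, where \<open>Y\<^sub>+\<close> and \<open>Y\<^sub>-\<close> are the (existing) limits of the
  row vector \<open>Y\<close> from the upper and lower half plane.\<close>

definition has_jump_at :: "(complex \<Rightarrow> complex^2) \<Rightarrow> complex^2^2 \<Rightarrow> complex \<Rightarrow> bool" where
  "has_jump_at Y J z \<longleftrightarrow>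
     (\<exists>Yp Ym. (Y \<longlongrightarrow> Yp) (at z within {w. Im w > 0}) \<and>
              (Y \<longlongrightarrow> Ym) (at z within {w. Im w < 0}) \<and>
              Yp = Ym v* J)"

text \<open>Values of \<open>Y\<close> on the contour itself are irrelevant and left unconstrained.\<close>

definition soliton_gas_RHP ::
  "real \<Rightarrow> real \<Rightarrow> (complex \<Rightarrow> complex) \<Rightarrow> real \<Rightarrow> real \<Rightarrow> (complex \<Rightarrow> complex^2) \<Rightarrow> bool" where
  "soliton_gas_RHP \<eta>1 \<eta>2 r x t Y \<longleftrightarrow>
     (\<forall>i. (\<lambda>z. Y z $ i) holomorphic_on - contour \<eta>1 \<eta>2) \<and>
     (\<forall>a \<in> {\<eta>1, \<eta>2, - \<eta>1, - \<eta>2}.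
        (\<lambda>z. norm (Y z)) \<in> O[at (of_real a) within - contour \<eta>1 \<eta>2](\<lambda>z. ln (norm (z - of_real a)))) \<and>
     (\<forall>z \<in> Sigma1 \<eta>1 \<eta>2. has_jump_at Y (jump1 r x t z) z) \<and>
     (\<forall>z \<in> Sigma2 \<eta>1 \<eta>2. has_jump_at Y (jump2 r x t z) z) \<and>
     (\<lambda>z. norm (Y z - vector [1, 1])) \<in> O[at_infinity](\<lambda>z. 1 / norm z) \<and>
     (\<forall>z \<in> - contour \<eta>1 \<eta>2. Y (- z) = Y z v* vector [vector [0, 1], vector [1, 0]])"

text \<open>The family \<open>Y\<close> is indexed as \<open>Y x t z\<close>. The value is a priori complex.\<close>

definition soliton_gas :: "(real \<Rightarrow> real \<Rightarrow> complex \<Rightarrow> complex^2) \<Rightarrow> real \<Rightarrow> real \<Rightarrow> complex" where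
  "soliton_gas Y x t =
     2 * vector_derivative (\<lambda>x'. Lim at_infinity (\<lambda>z. z * (Y x' t z $ 1 - 1))) (at x)"

end

(* Extend f = Y_1 analytically across [-eta2, -eta1] and put g(s) = f(-s) = Y_2(s). The
   Plemelj formula on [eta1, eta2] (all jumps removed, then Liouville) turns the Riemann-Hilbert
   problem into the integral equation
     g(s) = 1 - int w_x(u) g(u) / (u + s) du,    w_x(u) = r(u) exp(8 u^3 t - 2 u x) / (2 pi),
   and the limit of z (f(z) - 1) is m(x) = int w_x g_x. As the kernel 1/(u + s) is symmetric,
   m(x) - m(y) = int (w_x - w_y) g_x g_y, hence m'(x) = - int 2 u w_x g_x^2, for which only the
   continuity of g_x in x is needed. For x = 4 xi t with xi > eta2^2 the weight is
   O(exp(-8 eta1 (xi - eta2^2) t)); so for large t the integral operator is a contraction,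
   |g| <= 2, and u = 2 m' inherits the decay of the weight. *)
theory Submission
  imports Defs "HOL-Real_Asymp.Real_Asymp"
begin

subsection \<open>Cauchy integrals over a segment\<close>

text \<open>Boundary values are prescribed only pointwise on the open intervals, and the density of
  the Cauchy integral contains the unknown itself. The triangular shape of the jumps breaks this
  circle: the first component does not jump across the left segment, so it extends there, and by
  symmetry the second one extends across the right segment. The density is then holomorphic near the
  segment of integration, so the Cauchy integral splits into a continuous part and an explicit
  logarithm, in place of a theory of singular integrals.

  The problem says nothing about the dependence of \<open>Y\<close> on \<open>x\<close>, while
  \<open>u\<close> is an \<open>x\<close>-derivative. Differentiating the integral equation would
  call for a derivative of \<open>g_x\<close>; the bilinear identity moves the whole difference onto
  the weights, which are explicit exponentials in \<open>x\<close>. The bounds on \<open>g_x\<close>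
  are a priori bounds read off at a maximum point and hold for every continuous solution, so no
  Neumann series has to be summed. Since \<open>t\<close> is fixed while \<open>x\<close> varies,
  the weight must be controlled on a window around \<open>x = 4 xi t\<close>; a window of radius one
  costs only the factor \<open>exp (2 * eta2)\<close>.\<close>

lemma mem_real_closed_segment_iff:
  fixes a b :: real
  assumes "a \<le> b"
  shows "z \<in> closed_segment (complex_of_real a) (of_real b) \<longleftrightarrow> Im z = 0 \<and> a \<le> Re z \<and> Re z \<le> b"
  using assms by (auto simp: closed_segment_same_Im closed_segment_eq_real_ivl)

lemma Cauchy_integral_linepath_holomorphic:
  assumes "continuous_on (closed_segment a b) \<rho>"
  shows "(\<lambda>z. contour_integral (linepath a b) (\<lambda>w. \<rho> w / (w - z))) holomorphic_on - closed_segment a b"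
proof -
  have "\<exists>D. ((\<lambda>z. contour_integral (linepath a b) (\<lambda>w. \<rho> w / (w - z))) has_field_derivative D) (at z)"
    if "z \<in> - closed_segment a b" for z
  proof -
    \<comment> \<open>The power \<open>1\<close> is kept so that the integrand has the form expected
      by \<open>Cauchy_next_derivative\<close>.\<close>
    have "((\<lambda>u. \<rho> u / (u - w) ^ 1) has_contour_integral
        contour_integral (linepath a b) (\<lambda>u. \<rho> u / (u - w))) (linepath a b)"
      if "w \<in> UNIV - path_image (linepath a b)" for w
      using that assms
      by (auto intro!: has_contour_integral_integral contour_integrable_continuous_linepath continuous_intros)
    then show ?thesis
      using Cauchy_next_derivative(2)[of "linepath a b" \<rho> "norm (b - a)" UNIV 1
          "\<lambda>z. contour_integral (linepath a b) (\<lambda>w. \<rho> w / (w - z))" z] assms that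
      by fastforce
  qed
  then show ?thesis
    by (meson closed_segment open_Compl holomorphic_on_open)
qed

lemma Cauchy_integral_linepath_tendsto_0:
  assumes "continuous_on (closed_segment a b) \<rho>"
  shows "((\<lambda>z. contour_integral (linepath a b) (\<lambda>w. \<rho> w / (w - z))) \<longlongrightarrow> 0) at_infinity"
proof -
  have "bounded (\<rho> ` closed_segment a b)" "bounded (closed_segment a b)"
    using assms compact_continuous_image compact_imp_bounded compact_segment by blast+
  then obtain B R where B: "\<And>w. w \<in> closed_segment a b \<Longrightarrow> norm (\<rho> w) \<le> B"
    and R: "\<And>w. w \<in> closed_segment a b \<Longrightarrow> norm w \<le> R"
    unfolding bounded_iff by (metis imageI)
  have B0: "0 \<le> B" using B[of a] norm_ge_zero order_trans by (metis ends_in_segment(1))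
  have ev: "\<forall>\<^sub>F z in at_infinity. norm (contour_integral (linepath a b) (\<lambda>w. \<rho> w / (w - z)))
      \<le> B * norm (b - a) * (1 / (norm z - R))"
    unfolding eventually_at_infinity
  proof (intro exI[of _ "R+1"] allI impI)
    fix z :: complex assume z: "R + 1 \<le> norm z"
    then have zn: "z \<notin> closed_segment a b" using R[of z] by auto
    have "norm (contour_integral (linepath a b) (\<lambda>w. \<rho> w / (w - z))) \<le> B / (norm z - R) * norm (b - a)"
    proof (rule contour_integral_bound_linepath)
      show "(\<lambda>w. \<rho> w / (w - z)) contour_integrable_on linepath a b"
        using assms zn by (intro contour_integrable_continuous_linepath continuous_intros) auto
      show "0 \<le> B / (norm z - R)" using B0 z by auto
      fix w assume w: "w \<in> closed_segment a b"
      have "norm z - R \<le> norm (w - z)"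
        using R[OF w] norm_triangle_ineq2[of z w] by (simp add: norm_minus_commute)
      then show "norm (\<rho> w / (w - z)) \<le> B / (norm z - R)"
        unfolding norm_divide using B[OF w] z B0 by (intro frac_le) auto
    qed
    then show "norm (contour_integral (linepath a b) (\<lambda>w. \<rho> w / (w - z)))
      \<le> B * norm (b - a) * (1 / (norm z - R))" by (simp add: mult_ac)
  qed
  have "filterlim (\<lambda>z::complex. -R + norm z) at_top at_infinity"
    by (intro filterlim_tendsto_add_at_top[OF tendsto_const] filterlim_norm_at_top)
  then have "((\<lambda>z::complex. 1 / (norm z - R)) \<longlongrightarrow> 0) at_infinity"
    using tendsto_inverse_0_at_top by (simp add: inverse_eq_divide add.commute)
  from tendsto_mult_right_zero[OF this]
  have "((\<lambda>z::complex. B * norm (b - a) * (1 / (norm z - R))) \<longlongrightarrow> 0) at_infinity" .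
  then show ?thesis by (rule Lim_null_comparison[OF ev])
qed

text \<open>Since \<open>z / (w - z) = w / (w - z) - 1\<close>, the factor \<open>z\<close> turns
  the integral into a Cauchy integral with density \<open>\<rho> w * w\<close>, which vanishes at
  infinity, minus the plain integral of \<open>\<rho>\<close>. This yields the coefficient of
  \<open>1 / z\<close> without a series expansion.\<close>

lemma Cauchy_integral_linepath_moment:
  assumes "continuous_on (closed_segment a b) \<rho>"
  shows "((\<lambda>z. z * contour_integral (linepath a b) (\<lambda>w. \<rho> w / (w - z)))
            \<longlongrightarrow> - contour_integral (linepath a b) \<rho>) at_infinity"
proof -
  let ?I = "contour_integral (linepath a b)"
  have "((\<lambda>z. ?I (\<lambda>w. (\<rho> w * w) / (w - z)) - ?I \<rho>) \<longlongrightarrow> 0 - ?I \<rho>) at_infinity"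
    using assms by (intro tendsto_intros Cauchy_integral_linepath_tendsto_0 continuous_intros)
  moreover have "\<forall>\<^sub>F z in at_infinity. ?I (\<lambda>w. (\<rho> w * w) / (w - z)) - ?I \<rho> = z * ?I (\<lambda>w. \<rho> w / (w - z))"
  proof -
    have "\<forall>\<^sub>F z in at_infinity. z \<notin> closed_segment a b"
      using bounded_closed_segment[of a b] unfolding eventually_at_infinity bounded_iff
      by (metis linorder_not_less gt_ex order_less_le_trans)
    then show ?thesis
    proof eventually_elim
      case (elim z)
      have i: "(\<lambda>w. (\<rho> w * w) / (w - z)) contour_integrable_on linepath a b"
           "\<rho> contour_integrable_on linepath a b" "(\<lambda>w. \<rho> w / (w - z)) contour_integrable_on linepath a b"
        using assms elim by (auto intro!: contour_integrable_continuous_linepath continuous_intros)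
      have "?I (\<lambda>w. (\<rho> w * w) / (w - z)) - ?I \<rho> = ?I (\<lambda>w. (\<rho> w * w) / (w - z) - \<rho> w)"
        using i by (simp add: contour_integral_diff)
      also have "\<dots> = ?I (\<lambda>w. z * (\<rho> w / (w - z)))"
        using elim by (intro contour_integral_cong) (auto simp: divide_simps algebra_simps)
      finally show ?case by (simp only: contour_integral_lmul[OF i(3)])
    qed
  qed
  ultimately show ?thesis using Lim_transform_eventually by fastforce
qed

text \<open>The quotient \<open>(w - z) / (a - z)\<close> starts at 1 and stays off the branch cut
  while \<open>w\<close> runs through the segment, so its principal logarithm is a primitive that
  vanishes at \<open>w = a\<close>. A difference of \<open>Ln (b - z)\<close> and
  \<open>Ln (a - z)\<close> could be off by a multiple of \<open>2 * pi * \<i>\<close>.\<close>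

lemma contour_integral_linepath_inverse_eq_Ln:
  assumes "z \<notin> closed_segment a b"
  shows "contour_integral (linepath a b) (\<lambda>w. 1 / (w - z)) = Ln ((b - z) / (a - z))"
proof -
  have az: "a \<noteq> z" using assms by auto
  \<comment> \<open>A quotient \<open>k \<le> 0\<close> would make \<open>z\<close> a convex
    combination of \<open>w\<close> and \<open>a\<close>, with weight \<open>-k/(1-k)\<close> on
    \<open>a\<close>, and thus a point of the segment.\<close>
  have ne: "(w - z) / (a - z) \<notin> \<real>\<^sub>\<le>\<^sub>0" if w: "w \<in> closed_segment a b" for w
  proof
    assume "(w - z) / (a - z) \<in> \<real>\<^sub>\<le>\<^sub>0"
    then obtain k where k: "k \<le> 0" "(w - z) / (a - z) = of_real k" by (auto elim: nonpos_Reals_cases)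
    then have "w - z = of_real k * (a - z)" using az by (simp add: field_simps)
    then have "w - of_real k * a = of_real (1 - k) * z" by (simp add: algebra_simps)
    then have "z = (w - of_real k * a) / of_real (1 - k)"
      using k(1) by (simp add: nonzero_eq_divide_eq mult.commute)
    also have "\<dots> = (1 - (-k/(1-k))) *\<^sub>R w + (-k/(1-k)) *\<^sub>R a"
      using k(1) by (simp add: scaleR_conv_of_real divide_simps)
    finally have "z \<in> closed_segment w a"
      using k(1) unfolding closed_segment_def
      by (intro CollectI exI[of _ "-k/(1-k)"]) (auto simp: divide_simps)
    moreover have "closed_segment w a \<subseteq> closed_segment a b"
      using w by (simp add: subset_closed_segment)
    ultimately show False using assms by blast
  qed
  have "((\<lambda>w. 1 / (w - z)) has_contour_integral
     (Ln ((pathfinish (linepath a b) - z) / (a - z)) - Ln ((pathstart (linepath a b) - z) / (a - z)))) (linepath a b)"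
  proof (rule contour_integral_primitive[where S = "closed_segment a b"])
    fix w assume w: "w \<in> closed_segment a b"
    then have "w \<noteq> z" using assms by auto
    with ne[OF w] az show "((\<lambda>w. Ln ((w - z) / (a - z))) has_field_derivative 1 / (w - z)) (at w within closed_segment a b)"
      by (auto intro!: derivative_eq_intros simp: divide_simps)
  qed auto
  then show ?thesis using az by (simp add: contour_integral_unique)
qed

text \<open>On the open segment the quotient is negative, so it lies on the branch cut of
  \<open>Ln\<close>, and its imaginary part has the sign of \<open>Im z\<close>. Passing to the
  negated quotient, where \<open>Ln\<close> is continuous, leaves the corrections
  \<open>\<i> * pi\<close> and \<open>- \<i> * pi\<close>; their difference is the factor
  \<open>2 * pi * \<i>\<close> of the Plemelj formula.\<close>

lemma Ln_ratio_boundary_values: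
  fixes a b s :: real
  assumes "a < s" "s < b"
  defines "L \<equiv> Ln (of_real ((b - s) / (s - a)))"
  shows "((\<lambda>z. Ln ((of_real b - z) / (of_real a - z))) \<longlongrightarrow> L + \<i> * pi) (at (of_real s) within {w. Im w > 0})"
    and "((\<lambda>z. Ln ((of_real b - z) / (of_real a - z))) \<longlongrightarrow> L - \<i> * pi) (at (of_real s) within {w. Im w < 0})"
proof -
  let ?q = "\<lambda>z::complex. (of_real b - z) / (of_real a - z)"
  have im: "Im (?q z) = (b - a) * Im z / ((a - Re z)\<^sup>2 + (Im z)\<^sup>2)" for z
    by (simp add: Im_divide algebra_simps diff_divide_distrib)
  have pos: "(a - Re z)\<^sup>2 + (Im z)\<^sup>2 > 0" if "Im z \<noteq> 0" for z
    using that by (simp add: add_nonneg_pos)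
  have up: "Im (?q z) > 0" if "Im z > 0" for z
    using that assms pos[of z] unfolding im by auto
  have dn: "Im (?q z) < 0" if "Im z < 0" for z
    using that assms pos[of z] unfolding im by (auto intro!: divide_neg_pos mult_pos_neg)
  have lim: "((\<lambda>z. Ln (- ?q z)) \<longlongrightarrow> L) (at (of_real s) within S)" for S
  proof -
    have v: "- ?q (of_real s) = of_real ((b - s) / (s - a))"
      by (simp only: of_real_divide of_real_diff minus_divide_right minus_diff_eq)
    have "- ?q (of_real s) \<notin> \<real>\<^sub>\<le>\<^sub>0"
      using assms unfolding v nonpos_Reals_of_real_iff by (simp add: divide_le_0_iff)
    then have "((\<lambda>z. Ln (- ?q z)) \<longlongrightarrow> Ln (- ?q (of_real s))) (at (of_real s) within S)"
      using assms by (intro tendsto_intros) auto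
    then show ?thesis unfolding v L_def .
  qed
  have ne: "of_real c \<noteq> z" if "Im z \<noteq> 0" for c z using that by auto
  have 1: "Ln (?q z) = Ln (- ?q z) + \<i> * pi" if "Im z > 0" for z
    using Ln_minus[of "- ?q z"] up[OF that] ne[of z a] ne[of z b] that by auto
  have 2: "Ln (?q z) = Ln (- ?q z) - \<i> * pi" if "Im z < 0" for z
    using Ln_minus[of "- ?q z"] dn[OF that] ne[of z a] ne[of z b] that by auto
  show "((\<lambda>z. Ln (?q z)) \<longlongrightarrow> L + \<i> * pi) (at (of_real s) within {w. Im w > 0})"
    by (rule Lim_transform_within[where d=1, OF tendsto_add[OF lim tendsto_const]]) (auto simp: 1[symmetric])
  show "((\<lambda>z. Ln (?q z)) \<longlongrightarrow> L - \<i> * pi) (at (of_real s) within {w. Im w < 0})"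
    by (rule Lim_transform_within[where d=1, OF tendsto_diff[OF lim tendsto_const]]) (auto simp: 2[symmetric])
qed

lemma mult_ln_norm_tendsto_0:
  "((\<lambda>z::complex. norm (z - a) * ln (norm (z - a))) \<longlongrightarrow> 0) (at a within S)"
proof -
  have "((\<lambda>x::real. x * ln x) \<longlongrightarrow> 0) (at_right 0)" by real_asymp
  moreover have "filterlim (\<lambda>z. norm (z - a)) (at_right 0) (at a within S)"
    unfolding filterlim_at by (auto simp: eventually_at intro!: tendsto_eq_intros exI[of _ 1])
  ultimately show ?thesis by (rule filterlim_compose)
qed

text \<open>The real part of the logarithm is a difference of logarithms of distances and the
  imaginary part is bounded by \<open>pi\<close>. The growth at an endpoint is therefore
  logarithmic, and a linear factor defeats it.\<close>

lemma mult_Ln_ratio_tendsto_0: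
  assumes "a \<noteq> b" and "a \<notin> S" "b \<notin> S"
  shows "((\<lambda>z. (z - a) * Ln ((b - z) / (a - z))) \<longlongrightarrow> 0) (at a within S)"
    and "((\<lambda>z. (z - b) * Ln ((b - z) / (a - z))) \<longlongrightarrow> 0) (at b within S)"
proof -
  have key: "norm (Ln ((b - z) / (a - z))) \<le> \<bar>ln (norm (z - b))\<bar> + \<bar>ln (norm (z - a))\<bar> + pi" if "z \<in> S" for z
  proof -
    let ?w = "(b - z) / (a - z)"
    have nz: "z \<noteq> a" "z \<noteq> b" using that assms by auto
    have "norm (Ln ?w) \<le> \<bar>Re (Ln ?w)\<bar> + \<bar>Im (Ln ?w)\<bar>" by (rule cmod_le)
    also have "Re (Ln ?w) = ln (norm (z - b)) - ln (norm (z - a))"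
      using nz by (simp add: norm_divide ln_div norm_minus_commute)
    also have "\<bar>Im (Ln ?w)\<bar> \<le> pi"
      using mpi_less_Im_Ln[of ?w] Im_Ln_le_pi[of ?w] nz by auto
    finally show ?thesis by linarith
  qed
  have e: "\<forall>\<^sub>F z in at c within S. z \<in> S" for c by (simp add: eventually_at_filter)
  \<comment> \<open>The terms that stay bounded at \<open>c\<close>: the logarithm of the distance
    to the other endpoint, and the constant \<open>pi\<close>.\<close>
  have far: "((\<lambda>z. norm (z - c) * \<bar>ln (norm (z - d))\<bar>) \<longlongrightarrow> 0) (at c within S)"
    "((\<lambda>z. norm (z - c) * pi) \<longlongrightarrow> 0) (at c within S)" if "c \<noteq> d" for c d
  proof -
    have "((\<lambda>z. norm (z - c) * \<bar>ln (norm (z - d))\<bar>) \<longlongrightarrow> norm (c - c) * \<bar>ln (norm (c - d))\<bar>) (at c within S)"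
      "((\<lambda>z. norm (z - c) * pi) \<longlongrightarrow> norm (c - c) * pi) (at c within S)"
      using that by (intro tendsto_intros; simp)+
    then show "((\<lambda>z. norm (z - c) * \<bar>ln (norm (z - d))\<bar>) \<longlongrightarrow> 0) (at c within S)"
      "((\<lambda>z. norm (z - c) * pi) \<longlongrightarrow> 0) (at c within S)" by simp_all
  qed
  have 1: "((\<lambda>z. norm (z - a) * \<bar>ln (norm (z - b))\<bar> + \<bar>norm (z - a) * ln (norm (z - a))\<bar> + norm (z - a) * pi) \<longlongrightarrow> 0) (at a within S)"
    by (intro tendsto_add_zero tendsto_rabs_zero mult_ln_norm_tendsto_0 far[OF assms(1)])
  have 2: "((\<lambda>z. \<bar>norm (z - b) * ln (norm (z - b))\<bar> + norm (z - b) * \<bar>ln (norm (z - a))\<bar> + norm (z - b) * pi) \<longlongrightarrow> 0) (at b within S)"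
    by (intro tendsto_add_zero tendsto_rabs_zero mult_ln_norm_tendsto_0 far[OF assms(1)[symmetric]])
  show "((\<lambda>z. (z - a) * Ln ((b - z) / (a - z))) \<longlongrightarrow> 0) (at a within S)"
  proof (rule Lim_null_comparison[OF _ 1])
    show "\<forall>\<^sub>F z in at a within S. norm ((z - a) * Ln ((b - z) / (a - z))) \<le>
      norm (z - a) * \<bar>ln (norm (z - b))\<bar> + \<bar>norm (z - a) * ln (norm (z - a))\<bar> + norm (z - a) * pi"
      using e
    proof eventually_elim
      case (elim z)
      show ?case using mult_left_mono[OF key[OF elim], of "norm (z - a)"]
        by (simp add: norm_mult abs_mult distrib_left)
    qed
  qed
  show "((\<lambda>z. (z - b) * Ln ((b - z) / (a - z))) \<longlongrightarrow> 0) (at b within S)"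
  proof (rule Lim_null_comparison[OF _ 2])
    show "\<forall>\<^sub>F z in at b within S. norm ((z - b) * Ln ((b - z) / (a - z))) \<le>
      \<bar>norm (z - b) * ln (norm (z - b))\<bar> + norm (z - b) * \<bar>ln (norm (z - a))\<bar> + norm (z - b) * pi"
      using e
    proof eventually_elim
      case (elim z)
      show ?case using mult_left_mono[OF key[OF elim], of "norm (z - b)"]
        by (simp add: norm_mult abs_mult distrib_left)
    qed
  qed
qed

subsection \<open>Boundary values on a real segment\<close>

lemma at_within_half_plane_neq_bot [simp]:
  "at (complex_of_real s) within {w. Im w > 0} \<noteq> bot"
  "at (complex_of_real s) within {w. Im w < 0} \<noteq> bot"
proof -
  have "\<exists>x'\<in>{w. Im w > 0}. x' \<noteq> of_real s \<and> dist x' (of_real s) < e" if "e > 0" for e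
    using that by (intro bexI[of _ "Complex s (e/2)"]) (auto simp: dist_norm complex_eq_iff cmod_def)
  moreover have "\<exists>x'\<in>{w. Im w < 0}. x' \<noteq> of_real s \<and> dist x' (of_real s) < e" if "e > 0" for e
    using that by (intro bexI[of _ "Complex s (-e/2)"]) (auto simp: dist_norm complex_eq_iff cmod_def)
  ultimately show "at (complex_of_real s) within {w. Im w > 0} \<noteq> bot"
    "at (complex_of_real s) within {w. Im w < 0} \<noteq> bot"
    by (auto simp: trivial_limit_within islimpt_approachable)
qed

text \<open>An \<open>e\<close>-neighbourhood of a segment is the Minkowski sum of two convex sets.
  Convexity is what keeps the segment joining two points of the neighbourhood inside it when
  difference quotients are formed below.\<close>

lemma convex_neighbourhood_segment:
  fixes a b :: "'a :: euclidean_space"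
  assumes "open N" "closed_segment a b \<subseteq> N"
  obtains M where "open M" "convex M" "closed_segment a b \<subseteq> M" "M \<subseteq> N"
proof -
  obtain e where e: "e > 0" "(\<Union>x\<in>closed_segment a b. ball x e) \<subseteq> N"
    using compact_subset_open_imp_ball_epsilon_subset[OF compact_segment assms] .
  let ?M = "\<Union>x\<in>closed_segment a b. \<Union>y\<in>ball 0 e. {x + y}"
  have "open ?M" by (simp add: open_sums)
  moreover have "convex ?M" by (intro convex_sums) auto
  moreover have "closed_segment a b \<subseteq> ?M" using e(1) by force
  moreover have "x + y \<in> N" if "x \<in> closed_segment a b" "norm y < e" for x y
  proof -
    have "x + y \<in> ball x e" using that by (simp add: dist_norm)
    then show ?thesis using e(2) that by blast
  qed
  then have "?M \<subseteq> N" by auto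
  ultimately show ?thesis using that by blast
qed

text \<open>Writing \<open>\<rho> w = (\<rho> w - \<rho> z) + \<rho> z\<close> isolates the
  singularity: the difference quotient integrates to a function continuous across the segment, and
  everything discontinuous or unbounded sits in the explicit logarithm.\<close>

lemma Cauchy_integral_linepath_decomposition:
  assumes hol: "\<rho> holomorphic_on N" and N: "open N" "convex N" "closed_segment a b \<subseteq> N"
  obtains D where "continuous_on N D"
    "\<And>z. z \<in> N - closed_segment a b \<Longrightarrow>
       contour_integral (linepath a b) (\<lambda>w. \<rho> w / (w - z)) = D z + \<rho> z * Ln ((b - z) / (a - z))"
proof -
  \<comment> \<open>The difference quotient of \<open>\<rho>\<close>, written as the mean of its
    derivative over the segment from \<open>z\<close> to \<open>w\<close>. In this form it is
    jointly continuous, the diagonal \<open>w = z\<close> included.\<close>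
  define d where "d z w = integral (cbox 0 1) (\<lambda>t. deriv \<rho> (linepath z w t))" for z w
  have inN: "linepath z w t \<in> N" if "z \<in> N" "w \<in> N" "t \<in> cbox 0 1" for z w t
  proof -
    have "linepath z w t \<in> closed_segment z w" using that by (intro linepath_in_path) (simp add: cbox_interval)
    then show ?thesis using closed_segment_subset[of z N w] that N by blast
  qed
  have contd: "continuous_on (N \<times> N) (\<lambda>p. d (fst p) (snd p))"
    unfolding d_def
  proof (rule integral_continuous_on_param)
    have "continuous_on ((N \<times> N) \<times> cbox (0::real) 1)
        (\<lambda>q. deriv \<rho> (linepath (fst (fst q)) (snd (fst q)) (snd q)))"
    proof (rule continuous_on_compose2[of N "deriv \<rho>"])
      show "continuous_on N (deriv \<rho>)"
        using hol N holomorphic_deriv holomorphic_on_imp_continuous_on by blast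
      show "continuous_on ((N \<times> N) \<times> cbox (0::real) 1) (\<lambda>q. linepath (fst (fst q)) (snd (fst q)) (snd q))"
        unfolding linepath_def by (intro continuous_intros)
      show "(\<lambda>q. linepath (fst (fst q)) (snd (fst q)) (snd q)) ` ((N \<times> N) \<times> cbox 0 1) \<subseteq> N"
        using inN by auto
    qed
    then show "continuous_on ((N \<times> N) \<times> cbox 0 1) (\<lambda>(x, t). deriv \<rho> (linepath (fst x) (snd x) t))"
      by (simp add: case_prod_unfold)
  qed
  have contd2: "continuous_on (closed_segment a b) (d z)" if "z \<in> N" for z
  proof -
    have "continuous_on (closed_segment a b) (\<lambda>w. d (fst (z, w)) (snd (z, w)))"
      by (rule continuous_on_compose2[OF contd, where f = "\<lambda>w. (z, w)"])
        (use that N in \<open>auto intro!: continuous_intros\<close>)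
    then show ?thesis by simp
  qed
  have dq: "d z w = (\<rho> w - \<rho> z) / (w - z)" if "z \<in> N" "w \<in> N" "w \<noteq> z" for z w
  proof -
    have "(deriv \<rho> has_contour_integral (\<rho> (pathfinish (linepath z w)) - \<rho> (pathstart (linepath z w)))) (linepath z w)"
    proof (rule contour_integral_primitive[where S = N])
      show "(\<rho> has_field_derivative deriv \<rho> x) (at x within N)" if "x \<in> N" for x
        by (rule holomorphic_derivI[OF hol N(1) that])
      show "path_image (linepath z w) \<subseteq> N"
        using closed_segment_subset[OF that(1,2) N(2)] by simp
    qed simp
    then have "\<rho> w - \<rho> z = contour_integral (linepath z w) (deriv \<rho>)"
      by (simp add: contour_integral_unique)
    also have "\<dots> = d z w * (w - z)"
      unfolding contour_integral_integral d_def cbox_interval by simp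
    finally show ?thesis using that(3) by (metis eq_iff_diff_eq_0 nonzero_mult_div_cancel_right)
  qed
  define D where "D z = contour_integral (linepath a b) (d z)" for z
  show ?thesis
  proof
    show "continuous_on N D" unfolding D_def
    proof (rule contour_integral_continuous_on_linepath_2D[OF N(1) _ _ N(3)])
      show "continuous_on (N \<times> N) (\<lambda>(x, y). d x y)"
        using contd by (simp add: case_prod_unfold)
    qed (rule contour_integrable_continuous_linepath[OF contd2])
  next
    fix z assume z: "z \<in> N - closed_segment a b"
    let ?I = "contour_integral (linepath a b)"
    have c: "continuous_on (closed_segment a b) \<rho>"
      using hol N holomorphic_on_imp_continuous_on continuous_on_subset by blast
    have i: "(\<lambda>w. \<rho> w / (w - z)) contour_integrable_on (linepath a b)"
      "(\<lambda>w. 1 / (w - z)) contour_integrable_on (linepath a b)"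
      using c z by (auto intro!: contour_integrable_continuous_linepath continuous_intros)
    have "D z = ?I (\<lambda>w. \<rho> w / (w - z) - \<rho> z * (1 / (w - z)))"
      unfolding D_def
    proof (rule contour_integral_eq)
      fix w assume "w \<in> path_image (linepath a b)"
      then have "w \<in> N" "w \<noteq> z" using z N by auto
      then show "d z w = \<rho> w / (w - z) - \<rho> z * (1 / (w - z))"
        using dq z by (simp add: diff_divide_distrib)
    qed
    also have "\<dots> = ?I (\<lambda>w. \<rho> w / (w - z)) - \<rho> z * ?I (\<lambda>w. 1 / (w - z))"
      by (simp only: contour_integral_diff[OF i(1) contour_integrable_lmul[OF i(2)]] contour_integral_lmul[OF i(2)])
    finally show "?I (\<lambda>w. \<rho> w / (w - z)) = D z + \<rho> z * Ln ((b - z) / (a - z))"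
      using contour_integral_linepath_inverse_eq_Ln[of z a b] z by simp
  qed
qed

text \<open>Equal limits from both sides define values on the open segment, and continuity of these
  values along the segment comes for free because each is a full half-plane limit. A continuous
  function that is holomorphic on both sides of a line is holomorphic across it, and the two
  endpoints are then removable isolated singularities.\<close>

lemma holomorphic_extend_real_segment:
  fixes a b :: real
  defines "S \<equiv> closed_segment (complex_of_real a) (of_real b)"
  assumes "a < b" and U: "open U" "S \<subseteq> U" and hol: "F holomorphic_on U - S"
    and lims: "\<And>s. a < s \<Longrightarrow> s < b \<Longrightarrow>
       \<exists>l. (F \<longlongrightarrow> l) (at (of_real s) within {w. Im w > 0}) \<and> (F \<longlongrightarrow> l) (at (of_real s) within {w. Im w < 0})"
    and ends: "\<And>e. e = a \<or> e = b \<Longrightarrow> ((\<lambda>z. (z - of_real e) * F z) \<longlongrightarrow> 0) (at (of_real e) within - S)"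
  obtains G where "G holomorphic_on U" "\<And>z. z \<in> U - S \<Longrightarrow> G z = F z"
proof -
  have S: "z \<in> S \<longleftrightarrow> Im z = 0 \<and> a \<le> Re z \<and> Re z \<le> b" for z
    unfolding S_def by (rule mem_real_closed_segment_iff) (use assms(2) in simp)
  have closedS: "closed S" by (simp add: S_def)
  obtain l where l: "\<And>s. a < s \<Longrightarrow> s < b \<Longrightarrow> (F \<longlongrightarrow> l s) (at (of_real s) within {w. Im w > 0})"
      "\<And>s. a < s \<Longrightarrow> s < b \<Longrightarrow> (F \<longlongrightarrow> l s) (at (of_real s) within {w. Im w < 0})"
    using lims by metis
  define G where "G z = (if z \<in> S then l (Re z) else F z)" for z
  \<comment> \<open>A closed estimate in the upper half plane passes to the limit values on the
    segment. The case \<open>n = 0\<close> gives continuity at interior points; \<open>n = 1\<close>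
    with \<open>k = 0\<close> gives the decay needed at the endpoints.\<close>
  have bound: "norm ((of_real s - c) ^ n * l s - k) \<le> \<epsilon>"
    if s: "a < s" "s < b" and V: "open V" "of_real s \<in> V"
      and le: "\<And>w. w \<in> V \<Longrightarrow> Im w > 0 \<Longrightarrow> norm ((w - c) ^ n * F w - k) \<le> \<epsilon>" for s c n k \<epsilon> V
  proof (rule tendsto_upperbound)
    show "((\<lambda>w. norm ((w - c) ^ n * F w - k)) \<longlongrightarrow> norm ((of_real s - c) ^ n * l s - k))
        (at (of_real s) within {w. Im w > 0})"
      by (intro tendsto_norm tendsto_diff tendsto_mult tendsto_power tendsto_const tendsto_ident_at l(1) s)
    show "\<forall>\<^sub>F w in at (of_real s) within {w. Im w > 0}. norm ((w - c) ^ n * F w - k) \<le> \<epsilon>"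
      using eventually_nhds_in_open[OF V] unfolding eventually_at_filter
      by eventually_elim (use le in auto)
  qed simp
  have cont: "isCont G p" if p: "p \<in> U - {of_real a, of_real b}" for p
  proof (cases "p \<in> S")
    case False
    then have "p \<in> U - S" "open (U - S)" using p U closedS by auto
    then have "isCont F p"
      using hol holomorphic_on_imp_continuous_on continuous_on_eq_continuous_at by blast
    moreover have "\<forall>\<^sub>F z in nhds p. G z = F z"
      using eventually_nhds_in_open[OF \<open>open (U - S)\<close> \<open>p \<in> U - S\<close>] by eventually_elim (simp add: G_def)
    ultimately show ?thesis by (simp add: isCont_cong)
  next
    case True
    then obtain s where s: "p = of_real s" "a < s" "s < b"
      using p S[of p] that[of "Re p"] by (auto simp: complex_eq_iff)
    have "\<exists>d>0. \<forall>z. z \<noteq> p \<and> dist z p < d \<longrightarrow> dist (G z) (G p) < \<epsilon>" if "\<epsilon> > 0" for \<epsilon>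
    proof -
      have e2: "\<epsilon> / 2 > 0" using that by simp
      obtain d1 where d1: "d1 > 0" "\<And>w. Im w > 0 \<Longrightarrow> dist w p < d1 \<Longrightarrow> dist (F w) (l s) < \<epsilon> / 2"
        using l(1)[OF s(2,3)] e2 unfolding Lim_within s(1)
        by (metis (mono_tags, lifting) Im_complex_of_real dist_pos_lt less_irrefl mem_Collect_eq)
      obtain d2 where d2: "d2 > 0" "\<And>w. Im w < 0 \<Longrightarrow> dist w p < d2 \<Longrightarrow> dist (F w) (l s) < \<epsilon> / 2"
        using l(2)[OF s(2,3)] e2 unfolding Lim_within s(1)
        by (metis (mono_tags, lifting) Im_complex_of_real dist_pos_lt less_irrefl mem_Collect_eq)
      \<comment> \<open>The entries \<open>s - a\<close> and \<open>b - s\<close> keep the real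
        points of the disc inside the open segment, where \<open>l\<close> is known to be the limit
        of \<open>F\<close>.\<close>
      define d where "d = Min {d1, d2, s - a, b - s}"
      have d: "d > 0" "d \<le> d1" "d \<le> d2" "d \<le> s - a" "d \<le> b - s"
        unfolding d_def using d1 d2 s by auto
      have "dist (G z) (G p) < \<epsilon>" if z: "dist z p < d" for z
      proof -
        have Gp: "G p = l s" using True s by (simp add: G_def)
        consider "Im z > 0" | "Im z < 0" | "Im z = 0" by linarith
        then have "norm (G z - l s) \<le> \<epsilon> / 2"
        proof cases
          case 1
          then show ?thesis using d1(2)[of z] z d S[of z] by (auto simp: G_def dist_norm)
        next
          case 2
          then show ?thesis using d2(2)[of z] z d S[of z] by (auto simp: G_def dist_norm)
        next
          case 3
          then have zr: "z = of_real (Re z)" by (simp add: complex_eq_iff)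
          have "\<bar>Re z - s\<bar> < d"
            using z abs_Re_le_cmod[of "z - p"] s(1) by (simp add: dist_norm)
          then have r: "a < Re z" "Re z < b" using d by linarith+
          have "norm ((of_real (Re z) - 0) ^ 0 * l (Re z) - l s) \<le> \<epsilon> / 2"
          proof (rule bound[OF r, of "ball p d1"])
            show "complex_of_real (Re z) \<in> ball p d1"
              using zr z d by (metis dist_commute less_le_trans mem_ball)
            show "norm ((w - 0) ^ 0 * F w - l s) \<le> \<epsilon> / 2" if "w \<in> ball p d1" "Im w > 0" for w
              using d1(2)[of w] that by (simp add: dist_norm norm_minus_commute)
          qed simp
          moreover have "G z = l (Re z)" using 3 r S[of z] by (simp add: G_def)
          ultimately show ?thesis by simp
        qed
        then show ?thesis using that e2 Gp by (simp add: dist_norm)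
      qed
      then show ?thesis using d(1) by blast
    qed
    then show ?thesis unfolding isCont_def Lim_at by (auto simp: dist_commute)
  qed
  \<comment> \<open>The pasting line is the real axis: its normal is \<open>\<i>\<close>, and
    \<open>\<i> \<bullet> z\<close> is \<open>Im z\<close>.\<close>
  have holG: "G holomorphic_on U - {of_real a, of_real b}"
  proof (rule holomorphic_on_paste_across_line[where d = \<i> and k = 0])
    show "open (U - {complex_of_real a, of_real b})" using U by (simp add: open_Diff)
    have "G holomorphic_on U - S"
      using hol by (rule holomorphic_transform) (simp add: G_def)
    then show "G holomorphic_on (U - {of_real a, of_real b}) \<inter> {z. \<i> \<bullet> z < 0}"
      "G holomorphic_on (U - {of_real a, of_real b}) \<inter> {z. 0 < \<i> \<bullet> z}"
      using S by (auto elim!: holomorphic_on_subset simp: inner_complex_def)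
    show "continuous_on (U - {of_real a, of_real b}) G"
      using cont by (simp add: continuous_at_imp_continuous_on)
  qed simp
  have endsG: "((\<lambda>z. (z - of_real e) * G z) \<longlongrightarrow> 0) (at (of_real e))" if e: "e = a \<or> e = b" for e
    unfolding Lim_at
  proof (intro allI impI)
    fix \<epsilon> :: real assume "\<epsilon> > 0"
    then have e2: "\<epsilon> / 2 > 0" by simp
    obtain d1 where "d1 > 0" and
      *: "\<forall>w\<in>-S. 0 < dist w (of_real e) \<and> dist w (of_real e) < d1 \<longrightarrow> dist ((w - of_real e) * F w) 0 < \<epsilon> / 2"
      using ends[OF e, unfolded Lim_within] e2 by meson
    then have d1: "d1 > 0"
      "\<And>w. w \<notin> S \<Longrightarrow> w \<noteq> of_real e \<Longrightarrow> dist w (of_real e) < d1 \<Longrightarrow> norm ((w - of_real e) * F w) < \<epsilon> / 2"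
      by (auto simp del: dist_0_norm simp add: dist_norm)
    \<comment> \<open>Staying within \<open>b - a\<close> of \<open>e\<close> excludes the opposite
      endpoint, so a point of the segment near \<open>e\<close> other than \<open>e\<close> is
      interior.\<close>
    define d where "d = min d1 (b - a)"
    have d: "d > 0" "d \<le> d1" "d \<le> b - a" using d1 \<open>a < b\<close> by (auto simp: d_def)
    have "norm ((z - of_real e) * G z) \<le> \<epsilon> / 2" if z: "z \<noteq> of_real e" "dist z (of_real e) < d" for z
    proof (cases "z \<in> S")
      case False
      then show ?thesis using d1(2)[of z] z d by (auto simp: G_def)
    next
      case True
      then have zr: "z = of_real (Re z)" using S[of z] by (simp add: complex_eq_iff)
      have "\<bar>Re z - e\<bar> < d"
        using z abs_Re_le_cmod[of "z - of_real e"] by (simp add: dist_norm)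
      moreover have "Re z \<noteq> e" using z zr by auto
      ultimately have r: "a < Re z" "Re z < b"
        using d e S[of z] True by auto
      have "norm ((of_real (Re z) - of_real e) ^ 1 * l (Re z) - 0) \<le> \<epsilon> / 2"
      proof (rule bound[OF r, of "ball (of_real e) d1"])
        show "complex_of_real (Re z) \<in> ball (of_real e) d1"
          using zr z d by (metis dist_commute less_le_trans mem_ball)
        show "norm ((w - of_real e) ^ 1 * F w - 0) \<le> \<epsilon> / 2" if "w \<in> ball (of_real e) d1" "Im w > 0" for w
          using d1(2)[of w] that S[of w] by (force simp: dist_commute)
      qed simp
      moreover have "G z = l (Re z)" using True by (simp add: G_def)
      ultimately show ?thesis using zr by simp
    qed
    then show "\<exists>d>0. \<forall>z. 0 < dist z (of_real e) \<and> dist z (of_real e) < d \<longrightarrow> dist ((z - of_real e) * G z) 0 < \<epsilon>"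
      using d(1) e2 by (intro exI[of _ d]) fastforce
  qed
  have ab: "of_real a \<in> U" "of_real b \<in> U" using U S \<open>a < b\<close> by auto
  \<comment> \<open>The endpoints are removed one at a time: \<open>G1\<close> is holomorphic at
    \<open>a\<close> as well, and \<open>G2\<close> finally at \<open>b\<close>.\<close>
  have "of_real a \<in> interior (U - {complex_of_real b})"
    using U ab \<open>a < b\<close> by (simp add: interior_open open_Diff)
  moreover have "G holomorphic_on U - {of_real b} - {of_real a}"
    using holG by (simp add: Diff_insert2[symmetric] insert_commute)
  ultimately obtain G1 where G1: "G1 holomorphic_on U - {of_real b}"
      "\<And>z. z \<in> U - {of_real b} - {of_real a} \<Longrightarrow> G1 z = G z"
    using holomorphic_on_extend_lim[of G "U - {of_real b}" "of_real a"] endsG[of a] by blast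
  have limG1: "((\<lambda>z. (z - of_real b) * G1 z) \<longlongrightarrow> 0) (at (of_real b))"
  proof (rule Lim_transform_within_open[OF endsG[of b]])
    show "open (U - {complex_of_real a})" using U by (simp add: open_Diff)
    show "complex_of_real b \<in> U - {of_real a}" using ab \<open>a < b\<close> by auto
  qed (use G1 in auto)
  have "of_real b \<in> interior U" using U ab by (simp add: interior_open)
  from iffD2[OF holomorphic_on_extend_lim[OF G1(1) this] limG1]
  obtain G2 where G2: "G2 holomorphic_on U" "\<And>z. z \<in> U - {of_real b} \<Longrightarrow> G2 z = G1 z"
    by blast
  show ?thesis
  proof
    show "G2 z = F z" if "z \<in> U - S" for z
    proof -
      have "of_real a \<in> S" "of_real b \<in> S" using S[of "of_real a"] S[of "of_real b"] \<open>a < b\<close> by simp_all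
      then have "z \<in> U - {of_real b} - {of_real a}" using that by blast
      then have "G2 z = G z" using G1(2) G2(2) by simp
      then show ?thesis using that by (simp add: G_def)
    qed
  qed (rule G2)
qed

text \<open>By the decomposition above, the Cauchy integral jumps by
  \<open>2 * pi * \<i> * \<rho>\<close> and is at most logarithmic at the endpoints, so what remains
  after subtracting it from \<open>f\<close> satisfies the hypotheses of the extension lemma on the
  whole plane.\<close>

lemma Plemelj_representation:
  fixes a b :: real and \<rho> :: "complex \<Rightarrow> complex"
  defines "S \<equiv> closed_segment (complex_of_real a) (of_real b)"
  defines "C \<equiv> \<lambda>z. contour_integral (linepath (of_real a) (of_real b)) (\<lambda>w. \<rho> w / (w - z))"
  assumes "a < b" and N: "open N" "S \<subseteq> N" and hol\<rho>: "\<rho> holomorphic_on N"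
    and holf: "f holomorphic_on - S"
    and inf: "(f \<longlongrightarrow> c) at_infinity"
    and jump: "\<And>s. a < s \<Longrightarrow> s < b \<Longrightarrow>
       \<exists>fp fm. (f \<longlongrightarrow> fp) (at (of_real s) within {w. Im w > 0}) \<and>
               (f \<longlongrightarrow> fm) (at (of_real s) within {w. Im w < 0}) \<and> fp - fm = \<rho> (of_real s)"
    and ends: "\<And>e. e = a \<or> e = b \<Longrightarrow> ((\<lambda>z. (z - of_real e) * f z) \<longlongrightarrow> 0) (at (of_real e) within - S)"
    and z: "z \<notin> S"
  shows "f z = c + C z / (2 * pi * \<i>)"
proof -
  obtain M where M: "open M" "convex M" "S \<subseteq> M" "M \<subseteq> N"
    using convex_neighbourhood_segment N unfolding S_def by metis
  have hol\<rho>M: "\<rho> holomorphic_on M" using hol\<rho> M by (blast intro: holomorphic_on_subset)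
  define L where "L z = Ln ((complex_of_real b - z) / (of_real a - z))" for z
  obtain D where D: "continuous_on M D" "\<And>z. z \<in> M - S \<Longrightarrow> C z = D z + \<rho> z * L z"
    using Cauchy_integral_linepath_decomposition[OF hol\<rho>M M(1,2), of "of_real a" "of_real b"] M(3)
    unfolding C_def S_def L_def by metis
  have cont\<rho>: "continuous_on S \<rho>" "continuous_on M \<rho>"
    using hol\<rho>M M holomorphic_on_imp_continuous_on continuous_on_subset by blast+
  have S: "z \<in> S \<longleftrightarrow> Im z = 0 \<and> a \<le> Re z \<and> Re z \<le> b" for z
    unfolding S_def by (rule mem_real_closed_segment_iff) (use assms(3) in simp)
  have at: "(D \<longlongrightarrow> D p) (at p within T)" "(\<rho> \<longlongrightarrow> \<rho> p) (at p within T)" if "p \<in> S" for p T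
  proof -
    have "isCont D p" "isCont \<rho> p"
      using D(1) cont\<rho>(2) that M(3) continuous_on_eq_continuous_at[OF M(1)] by blast+
    then show "(D \<longlongrightarrow> D p) (at p within T)" "(\<rho> \<longlongrightarrow> \<rho> p) (at p within T)"
      unfolding isCont_def by (auto elim: tendsto_within_subset)
  qed
  have evM: "\<forall>\<^sub>F z in at p within T. C z = D z + \<rho> z * L z" if "p \<in> S" "T \<subseteq> - S" for p T
  proof -
    have "p \<in> M" using that M by blast
    from eventually_nhds_in_open[OF M(1) this] show ?thesis
      unfolding eventually_at_filter
      by eventually_elim (use D(2) that(2) in blast)
  qed
  have half: "{w. Im w > 0} \<subseteq> - S" "{w. Im w < 0} \<subseteq> - S" using S by auto
  define F where "F z = f z - c - C z / (2 * pi * \<i>)" for z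
  have holC: "C holomorphic_on - S"
    unfolding C_def S_def by (rule Cauchy_integral_linepath_holomorphic) (use cont\<rho> S_def in simp)
  obtain G where G: "G holomorphic_on UNIV" "\<And>z. z \<in> UNIV - S \<Longrightarrow> G z = F z"
  proof (rule holomorphic_extend_real_segment[of a b UNIV F, folded S_def])
    show "F holomorphic_on UNIV - S"
      unfolding F_def using holf holC by (auto intro!: holomorphic_intros simp: Compl_eq_Diff_UNIV)
  next
    fix s assume s: "a < s" "s < b"
    then have sS: "of_real s \<in> S" using S by simp
    obtain fp fm where f: "(f \<longlongrightarrow> fp) (at (of_real s) within {w. Im w > 0})"
      "(f \<longlongrightarrow> fm) (at (of_real s) within {w. Im w < 0})" "fp - fm = \<rho> (of_real s)"
      using jump[OF s] by blast
    define k where "k = Ln (of_real ((b - s) / (s - a)))"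
    have C: "(C \<longlongrightarrow> D (of_real s) + \<rho> (of_real s) * (k + \<i> * pi)) (at (of_real s) within {w. Im w > 0})"
      "(C \<longlongrightarrow> D (of_real s) + \<rho> (of_real s) * (k - \<i> * pi)) (at (of_real s) within {w. Im w < 0})"
      unfolding tendsto_cong[OF evM[OF sS half(1)]] tendsto_cong[OF evM[OF sS half(2)]] L_def k_def
      by (intro tendsto_intros at sS Ln_ratio_boundary_values s)+
    \<comment> \<open>Both Cauchy limits share \<open>D\<close> and \<open>k\<close>; the two shifts
      by \<open>pi\<close> differ by \<open>2 * pi * \<i>\<close>, which after division leaves
      exactly \<open>\<rho> (of_real s) = fp - fm\<close>.\<close>
    have "fp - c - (D (of_real s) + \<rho> (of_real s) * (k + \<i> * pi)) / (2 * pi * \<i>)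
        = fm - c - (D (of_real s) + \<rho> (of_real s) * (k - \<i> * pi)) / (2 * pi * \<i>)"
    proof -
      have "D (of_real s) + \<rho> (of_real s) * (k + \<i> * pi)
          = D (of_real s) + \<rho> (of_real s) * (k - \<i> * pi) + \<rho> (of_real s) * (2 * pi * \<i>)"
        by (simp add: algebra_simps)
      then have "(D (of_real s) + \<rho> (of_real s) * (k + \<i> * pi)) / (2 * pi * \<i>)
          = (D (of_real s) + \<rho> (of_real s) * (k - \<i> * pi)) / (2 * pi * \<i>) + \<rho> (of_real s)"
        by (simp only: add_divide_distrib) simp
      then show ?thesis using f(3) by (simp add: algebra_simps)
    qed
    moreover have "(F \<longlongrightarrow> fp - c - (D (of_real s) + \<rho> (of_real s) * (k + \<i> * pi)) / (2 * pi * \<i>))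
        (at (of_real s) within {w. Im w > 0})"
      "(F \<longlongrightarrow> fm - c - (D (of_real s) + \<rho> (of_real s) * (k - \<i> * pi)) / (2 * pi * \<i>))
        (at (of_real s) within {w. Im w < 0})"
      unfolding F_def by (intro tendsto_intros f C; simp)+
    ultimately show "\<exists>l. (F \<longlongrightarrow> l) (at (of_real s) within {w. Im w > 0}) \<and>
        (F \<longlongrightarrow> l) (at (of_real s) within {w. Im w < 0})" by metis
  next
    fix e assume e: "e = a \<or> e = b"
    then have eS: "complex_of_real e \<in> S" using S \<open>a < b\<close> by auto
    have ne: "complex_of_real a \<noteq> of_real b" using \<open>a < b\<close> by simp
    have abS: "complex_of_real a \<notin> - S" "complex_of_real b \<notin> - S" using S \<open>a < b\<close> by auto
    have L: "((\<lambda>z. (z - of_real e) * L z) \<longlongrightarrow> 0) (at (of_real e) within - S)"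
      using e mult_Ln_ratio_tendsto_0[OF ne abS] unfolding L_def by auto
    have "((\<lambda>z. (z - of_real e) * D z + \<rho> z * ((z - of_real e) * L z)) \<longlongrightarrow>
        (of_real e - of_real e) * D (of_real e) + \<rho> (of_real e) * 0) (at (of_real e) within - S)"
      by (intro tendsto_intros at eS L)
    moreover have "\<forall>\<^sub>F z in at (of_real e) within - S.
        (z - of_real e) * D z + \<rho> z * ((z - of_real e) * L z) = (z - of_real e) * C z"
      using evM[OF eS order_refl] by eventually_elim (simp add: algebra_simps)
    ultimately have C: "((\<lambda>z. (z - of_real e) * C z) \<longlongrightarrow> 0) (at (of_real e) within - S)"
      using Lim_transform_eventually by fastforce
    have "((\<lambda>z. (z - of_real e) * f z - (z - of_real e) * c - (z - of_real e) * C z / (2 * pi * \<i>)) \<longlongrightarrow>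
      0 - (of_real e - of_real e) * c - 0 / (2 * pi * \<i>)) (at (of_real e) within - S)"
      by (intro tendsto_intros ends[OF e] C) auto
    then show "((\<lambda>z. (z - of_real e) * F z) \<longlongrightarrow> 0) (at (of_real e) within - S)"
      unfolding F_def by (simp add: algebra_simps)
  qed (use assms(3) in auto)
  have "(F \<longlongrightarrow> c - c - 0 / (2 * pi * \<i>)) at_infinity"
    unfolding F_def C_def using cont\<rho>(1)
    by (intro tendsto_intros inf Cauchy_integral_linepath_tendsto_0) (auto simp: S_def)
  moreover have "\<forall>\<^sub>F z in at_infinity. F z = G z"
  proof -
    have "\<forall>\<^sub>F z in at_infinity. z \<notin> S"
      using bounded_closed_segment unfolding eventually_at_infinity bounded_iff S_def
      by (metis linorder_not_less gt_ex order_less_le_trans)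
    then show ?thesis by eventually_elim (use G in simp)
  qed
  ultimately have "(G \<longlongrightarrow> 0) at_infinity"
    using Lim_transform_eventually by fastforce
  then have "F z = 0" using Liouville_weak_0[OF G(1)] G(2) z by simp
  then show ?thesis unfolding F_def by (simp add: algebra_simps)
qed

subsection \<open>The integral equation\<close>

locale segment_equation =
  fixes a b :: real
  assumes a: "0 < a" and ab: "a < b"
begin

definition S :: "complex set" where
  "S = closed_segment (of_real a) (of_real b)"

definition I :: "(complex \<Rightarrow> complex) \<Rightarrow> complex" where
  "I = contour_integral (linepath (of_real a) (of_real b))"

text \<open>The Cauchy kernel \<open>1 / (u - z)\<close> evaluated at \<open>z = - s\<close> becomes
  \<open>1 / (u + s)\<close>. It is nonsingular because both points lie at or to the right of
  \<open>a > 0\<close>, so this is a Fredholm equation with a continuous symmetric kernel.\<close>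

definition solves :: "(complex \<Rightarrow> complex) \<Rightarrow> (complex \<Rightarrow> complex) \<Rightarrow> bool" where
  "solves w g \<longleftrightarrow> continuous_on S w \<and> continuous_on S g \<and>
     (\<forall>s\<in>S. g s = 1 - I (\<lambda>u. w u * g u / (u + s)))"

lemma mem_S: "z \<in> S \<longleftrightarrow> Im z = 0 \<and> a \<le> Re z \<and> Re z \<le> b"
  unfolding S_def by (rule mem_real_closed_segment_iff) (use ab in simp)

lemma norm_add_S: "2 * a \<le> norm (u + s)" if "u \<in> S" "s \<in> S"
  using that complex_Re_le_cmod[of "u + s"] by (simp add: mem_S)

lemma norm_S: "norm u \<le> b" if "u \<in> S"
  using that a cmod_le[of u] by (simp add: mem_S)

lemma add_S_nonzero: "u + s \<noteq> 0" if "u \<in> S" "s \<in> S"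
  using norm_add_S[OF that] a by auto

lemma integrable: "f contour_integrable_on linepath (of_real a) (of_real b)" if "continuous_on S f"
  using that unfolding S_def by (rule contour_integrable_continuous_linepath)

lemma I_add: "I (\<lambda>u. f u + h u) = I f + I h" if "continuous_on S f" "continuous_on S h"
  unfolding I_def by (intro contour_integral_add integrable that)

lemma I_diff: "I (\<lambda>u. f u - h u) = I f - I h" if "continuous_on S f" "continuous_on S h"
  unfolding I_def by (intro contour_integral_diff integrable that)

lemma I_lmul: "I (\<lambda>u. c * f u) = c * I f" if "continuous_on S f"
  unfolding I_def by (intro contour_integral_lmul integrable that)

lemma I_cong: "I f = I h" if "\<And>u. u \<in> S \<Longrightarrow> f u = h u"
  unfolding I_def by (rule contour_integral_eq) (use that in \<open>simp add: S_def\<close>)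

lemma I_bound: "norm (I f) \<le> B * (b - a)"
  if "continuous_on S f" "0 \<le> B" "\<And>u. u \<in> S \<Longrightarrow> norm (f u) \<le> B"
proof -
  have "norm (I f) \<le> B * norm (complex_of_real b - of_real a)"
    unfolding I_def by (rule contour_integral_bound_linepath) (use that integrable in \<open>auto simp: S_def\<close>)
  also have "norm (complex_of_real b - of_real a) = b - a"
    using ab by (metis abs_of_pos diff_gt_0_iff_gt norm_of_real of_real_diff)
  finally show ?thesis .
qed

section \<open>A priori bounds when the weight is small\<close>

lemma continuous_on_kernel:
  "continuous_on S (\<lambda>u. f u / (u + s))" if "continuous_on S f" "s \<in> S"
  using that add_S_nonzero by (intro continuous_intros) auto

lemma kernel_bound: "norm (I (\<lambda>u. f u / (u + s))) \<le> B * ((b - a) / (2 * a))"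
  if f: "continuous_on S f" "s \<in> S" and B: "0 \<le> B" "\<And>u. u \<in> S \<Longrightarrow> norm (f u) \<le> B"
proof -
  have "norm (I (\<lambda>u. f u / (u + s))) \<le> B / (2 * a) * (b - a)"
  proof (rule I_bound[OF continuous_on_kernel[OF f]])
    show "norm (f u / (u + s)) \<le> B / (2 * a)" if "u \<in> S" for u
      unfolding norm_divide using B(1) B(2)[OF that] norm_add_S[OF that f(2)] a
      by (intro frac_le) auto
  qed (use B a in simp)
  then show ?thesis by simp
qed

text \<open>At a point \<open>m\<close> where \<open>norm (h m)\<close> is maximal, the integral
  contributes at most half of that maximum, which can be absorbed on the left. The general
  \<open>k\<close> serves both a single solution, with \<open>k = 1\<close>, and a difference of two
  solutions.\<close>

lemma contraction_bound:
  assumes h: "continuous_on S h" and w: "continuous_on S w" "\<And>u. u \<in> S \<Longrightarrow> norm (w u) \<le> W"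
    and W: "W * ((b - a) / (2 * a)) \<le> 1 / 2"
    and le: "\<And>s. s \<in> S \<Longrightarrow> norm (h s) \<le> k + norm (I (\<lambda>u. w u * h u / (u + s)))"
    and s: "s \<in> S"
  shows "norm (h s) \<le> 2 * k"
proof -
  have "S \<noteq> {}" "compact S" by (auto simp: S_def)
  then obtain m where m: "m \<in> S" "\<And>u. u \<in> S \<Longrightarrow> norm (h u) \<le> norm (h m)"
    using continuous_attains_sup[of S "\<lambda>u. norm (h u)"] h continuous_on_norm by blast
  have W0: "0 \<le> W" using w(2)[OF s] norm_ge_zero order_trans by blast
  have "norm (I (\<lambda>u. w u * h u / (u + m))) \<le> (W * norm (h m)) * ((b - a) / (2 * a))"
  proof (rule kernel_bound)
    show "norm (w u * h u) \<le> W * norm (h m)" if "u \<in> S" for u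
      unfolding norm_mult using w(2)[OF that] m(2)[OF that] W0 by (intro mult_mono) auto
  qed (use w h m W0 in \<open>auto intro!: continuous_intros\<close>)
  also have "\<dots> = norm (h m) * (W * ((b - a) / (2 * a)))" by simp
  also have "\<dots> \<le> norm (h m) * (1 / 2)" by (intro mult_left_mono W) simp
  finally show ?thesis using le[OF m(1)] m(2)[OF s] by simp
qed

lemma solution_bound:
  assumes "solves w g" "\<And>u. u \<in> S \<Longrightarrow> norm (w u) \<le> W" "W * ((b - a) / (2 * a)) \<le> 1 / 2" "s \<in> S"
  shows "norm (g s) \<le> 2"
proof -
  have "norm (g s) \<le> 2 * 1"
  proof (rule contraction_bound[where h = g and w = w and W = W])
    show "norm (g s) \<le> 1 + norm (I (\<lambda>u. w u * g u / (u + s)))" if "s \<in> S" for s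
      using assms(1) that norm_triangle_ineq4[of 1 "I (\<lambda>u. w u * g u / (u + s))"]
      unfolding solves_def by auto
  qed (use assms in \<open>auto simp: solves_def\<close>)
  then show ?thesis by simp
qed

text \<open>The identity \<open>w1 * g1 - w2 * g2 = w1 * (g1 - g2) + (w1 - w2) * g2\<close>
  separates a part that the contraction absorbs from a forcing term of size
  \<open>d * 2 * ((b - a) / (2 * a))\<close>. It makes the solution Lipschitz in the weight.\<close>

lemma solution_diff_bound:
  assumes 1: "solves w1 g1" and 2: "solves w2 g2"
    and W: "\<And>u. u \<in> S \<Longrightarrow> norm (w1 u) \<le> W" "\<And>u. u \<in> S \<Longrightarrow> norm (w2 u) \<le> W" "W * ((b - a) / (2 * a)) \<le> 1 / 2"
    and d: "\<And>u. u \<in> S \<Longrightarrow> norm (w1 u - w2 u) \<le> d"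
    and s: "s \<in> S"
  shows "norm (g1 s - g2 s) \<le> 2 * (d * ((b - a) / a))"
proof (rule contraction_bound[where h = "\<lambda>s. g1 s - g2 s" and w = w1 and W = W])
  have c: "continuous_on S w1" "continuous_on S w2" "continuous_on S g1" "continuous_on S g2"
    using 1 2 by (auto simp: solves_def)
  then show "continuous_on S w1" "continuous_on S (\<lambda>s. g1 s - g2 s)" by (auto intro: continuous_intros)
  fix s assume s: "s \<in> S"
  have d0: "0 \<le> d" using d[OF s] norm_ge_zero order_trans by blast
  have "I (\<lambda>u. w1 u * g1 u / (u + s)) - I (\<lambda>u. w2 u * g2 u / (u + s))
      = I (\<lambda>u. w1 u * (g1 u - g2 u) / (u + s) + (w1 u - w2 u) * g2 u / (u + s))"
    using c s by (subst I_diff[symmetric])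
      (auto intro!: continuous_on_kernel continuous_intros I_cong simp: algebra_simps diff_divide_distrib add_divide_distrib)
  also have "\<dots> = I (\<lambda>u. w1 u * (g1 u - g2 u) / (u + s)) + I (\<lambda>u. (w1 u - w2 u) * g2 u / (u + s))"
    using c s by (intro I_add continuous_on_kernel continuous_intros)
  finally have eq: "I (\<lambda>u. w1 u * g1 u / (u + s)) - I (\<lambda>u. w2 u * g2 u / (u + s))
      = I (\<lambda>u. w1 u * (g1 u - g2 u) / (u + s)) + I (\<lambda>u. (w1 u - w2 u) * g2 u / (u + s))" .
  have "g1 s - g2 s = - (I (\<lambda>u. w1 u * g1 u / (u + s)) - I (\<lambda>u. w2 u * g2 u / (u + s)))"
    using 1 2 s by (simp add: solves_def)
  then have "g1 s - g2 s = - (I (\<lambda>u. w1 u * (g1 u - g2 u) / (u + s)) + I (\<lambda>u. (w1 u - w2 u) * g2 u / (u + s)))"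
    unfolding eq .
  then have tri: "norm (g1 s - g2 s) \<le>
      norm (I (\<lambda>u. w1 u * (g1 u - g2 u) / (u + s))) + norm (I (\<lambda>u. (w1 u - w2 u) * g2 u / (u + s)))"
    by (simp only: norm_minus_cancel norm_triangle_ineq)
  have "norm (I (\<lambda>u. (w1 u - w2 u) * g2 u / (u + s))) \<le> d * 2 * ((b - a) / (2 * a))"
  proof (rule kernel_bound)
    show "norm ((w1 u - w2 u) * g2 u) \<le> d * 2" if "u \<in> S" for u
      unfolding norm_mult using d[OF that] d0 solution_bound[OF 2 W(2,3) that] by (intro mult_mono) auto
  qed (use c s d0 in \<open>auto intro!: continuous_intros\<close>)
  then have "norm (I (\<lambda>u. (w1 u - w2 u) * g2 u / (u + s))) \<le> d * ((b - a) / a)" by simp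
  from order_trans[OF tri add_left_mono[OF this]]
  show "norm (g1 s - g2 s) \<le> d * ((b - a) / a) + norm (I (\<lambda>u. w1 u * (g1 u - g2 u) / (u + s)))"
    by (simp only: add.commute)
qed (use W s in auto)

text \<open>Replace the factor 1 in the first moment by
  \<open>g2 s + I (\<lambda>u. w2 u * g2 u / (u + s))\<close>, and in the second by the
  corresponding expression for \<open>g1\<close>. Both moments then acquire the same double
  integral, up to the order of integration, and it cancels.\<close>

lemma moment_diff:
  assumes 1: "solves w1 g1" and 2: "solves w2 g2"
  shows "I (\<lambda>u. w1 u * g1 u) - I (\<lambda>u. w2 u * g2 u) = I (\<lambda>u. (w1 u - w2 u) * g1 u * g2 u)"
proof -
  have c: "continuous_on S w1" "continuous_on S w2" "continuous_on S g1" "continuous_on S g2"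
    using 1 2 by (auto simp: solves_def)
  define P where "P s u = w1 s * g1 s * (w2 u * g2 u) / (u + s)" for s u
  have contP: "continuous_on (S \<times> S) (\<lambda>(s, u). P s u)"
    unfolding P_def case_prod_unfold
    by (intro continuous_intros continuous_on_compose2[OF c(1)] continuous_on_compose2[OF c(2)]
        continuous_on_compose2[OF c(3)] continuous_on_compose2[OF c(4)]) (auto simp: add_S_nonzero)
  have swap: "I (\<lambda>s. I (P s)) = I (\<lambda>u. I (\<lambda>s. P s u))"
    unfolding I_def by (rule contour_integral_swap) (use contP in \<open>auto simp: S_def\<close>)
  have "I (\<lambda>s. w1 s * g1 s) = I (\<lambda>s. w1 s * g1 s * g2 s) + I (\<lambda>s. I (P s))"
  proof -
    have "I (\<lambda>s. I (P s)) = I (\<lambda>s. w1 s * g1 s - w1 s * g1 s * g2 s)"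
    proof (rule I_cong)
      fix s assume s: "s \<in> S"
      have "I (P s) = I (\<lambda>u. w1 s * g1 s * (w2 u * g2 u / (u + s)))"
        by (rule I_cong) (simp add: P_def)
      also have "\<dots> = w1 s * g1 s * I (\<lambda>u. w2 u * g2 u / (u + s))"
        using c s by (intro I_lmul continuous_on_kernel continuous_intros)
      also have "I (\<lambda>u. w2 u * g2 u / (u + s)) = 1 - g2 s" using 2 s by (simp add: solves_def)
      finally show "I (P s) = w1 s * g1 s - w1 s * g1 s * g2 s" by (simp add: algebra_simps)
    qed
    also have "\<dots> = I (\<lambda>s. w1 s * g1 s) - I (\<lambda>s. w1 s * g1 s * g2 s)"
      using c by (intro I_diff continuous_intros)
    finally show ?thesis by simp
  qed
  moreover have "I (\<lambda>u. w2 u * g2 u) = I (\<lambda>u. w2 u * g1 u * g2 u) + I (\<lambda>u. I (\<lambda>s. P s u))"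
  proof -
    have "I (\<lambda>u. I (\<lambda>s. P s u)) = I (\<lambda>u. w2 u * g2 u - w2 u * g1 u * g2 u)"
    proof (rule I_cong)
      fix u assume u: "u \<in> S"
      have "I (\<lambda>s. P s u) = I (\<lambda>s. w2 u * g2 u * (w1 s * g1 s / (s + u)))"
        by (rule I_cong) (simp add: P_def mult_ac add_ac)
      also have "\<dots> = w2 u * g2 u * I (\<lambda>s. w1 s * g1 s / (s + u))"
        using c u by (intro I_lmul continuous_on_kernel continuous_intros)
      also have "I (\<lambda>s. w1 s * g1 s / (s + u)) = 1 - g1 u" using 1 u by (simp add: solves_def)
      finally show "I (\<lambda>s. P s u) = w2 u * g2 u - w2 u * g1 u * g2 u" by (simp add: algebra_simps)
    qed
    also have "\<dots> = I (\<lambda>u. w2 u * g2 u) - I (\<lambda>u. w2 u * g1 u * g2 u)"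
      using c by (intro I_diff continuous_intros)
    finally show ?thesis by simp
  qed
  moreover have "I (\<lambda>u. (w1 u - w2 u) * g1 u * g2 u) = I (\<lambda>u. w1 u * g1 u * g2 u) - I (\<lambda>u. w2 u * g1 u * g2 u)"
    using c by (subst I_diff[symmetric]) (auto intro!: continuous_intros simp: algebra_simps)
  ultimately show ?thesis using swap by simp
qed

text \<open>By \<open>moment_diff\<close> only the weight is expanded to first order in
  \<open>x - x0\<close>; replacing \<open>g x\<close> by \<open>g x0\<close> in the linear term
  costs another factor \<open>\<bar>x - x0\<bar>\<close> by the Lipschitz bound. The total error is
  thus quadratic.\<close>

lemma moment_has_vector_derivative:
  fixes w g :: "real \<Rightarrow> complex \<Rightarrow> complex"
  assumes sol: "\<And>x. \<bar>x - x0\<bar> \<le> 1 \<Longrightarrow> solves (w x) (g x)"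
    and W: "\<And>x u. \<bar>x - x0\<bar> \<le> 1 \<Longrightarrow> u \<in> S \<Longrightarrow> norm (w x u) \<le> W" "W * ((b - a) / (2 * a)) \<le> 1 / 2"
    and w: "\<And>x u. w x u = w x0 u * exp (- 2 * u * of_real (x - x0))"
  shows "((\<lambda>x. I (\<lambda>u. w x u * g x u)) has_vector_derivative
           I (\<lambda>u. - 2 * u * w x0 u * (g x0 u)\<^sup>2)) (at x0)"
proof -
  let ?m = "\<lambda>x. I (\<lambda>u. w x u * g x u)" and ?D = "I (\<lambda>u. - 2 * u * w x0 u * (g x0 u)\<^sup>2)"
  \<comment> \<open>\<open>K\<close> bounds the second-order remainder of
    \<open>exp (- 2 * u * h)\<close> for \<open>norm u \<le> b\<close> and
    \<open>\<bar>h\<bar> \<le> 1\<close>, relative to \<open>h\<close> squared. \<open>L\<close> is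
    the resulting Lipschitz constant of the weight in \<open>x\<close>. \<open>Q\<close> adds the
    bounds for the two summands of \<open>T\<close> below, each remaining factor \<open>g\<close>
    being bounded by 2.\<close>
  define K where "K = exp (2 * b) * (2 * b)\<^sup>2"
  define L where "L = W * (2 * b + K)"
  define Q where "Q = W * K * (2 * 2) + 2 * b * W * (2 * (L * ((b - a) / a))) * 2"
  have b0: "0 < b" and K0: "0 \<le> K" using a ab by (auto simp: K_def)
  have aS: "of_real a \<in> S" using ab by (simp add: mem_S)
  have "norm (w x0 (of_real a)) \<le> W" by (rule W(1)) (use aS in auto)
  then have W0: "0 \<le> W" using norm_ge_zero order_trans by blast
  have L0: "0 \<le> L" using W0 b0 K0 by (simp add: L_def)
  have Q0: "0 \<le> Q" using W0 b0 K0 L0 a ab by (simp add: Q_def)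
  have main: "norm (?m x - ?m x0 - of_real (x - x0) * ?D) \<le> Q * (b - a) * (x - x0)\<^sup>2" if x: "\<bar>x - x0\<bar> \<le> 1" for x
  proof -
    define h where "h = x - x0"
    have h: "\<bar>h\<bar> \<le> 1" using x by (simp add: h_def)
    have s0: "solves (w x0) (g x0)" and sx: "solves (w x) (g x)" using sol x by auto
    have c: "continuous_on S (w x0)" "continuous_on S (w x)" "continuous_on S (g x0)" "continuous_on S (g x)"
      using s0 sx by (auto simp: solves_def)
    define R where "R u = w x u - w x0 u - of_real h * (- 2 * u * w x0 u)" for u
    have z: "norm (- 2 * u * of_real h) \<le> 2 * b * \<bar>h\<bar>" if "u \<in> S" for u
      using norm_S[OF that] by (simp add: norm_mult mult_right_mono)
    have R: "norm (R u) \<le> W * (K * h\<^sup>2)" if u: "u \<in> S" for u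
    proof -
      let ?z = "- 2 * u * of_real h"
      have "R u = w x0 u * (exp ?z - 1 - ?z)"
        unfolding R_def w[of x] h_def by (simp add: algebra_simps)
      moreover have "norm (exp ?z - 1 - ?z) \<le> K * h\<^sup>2"
      proof -
        have "norm (exp ?z - 1 - ?z) \<le> exp \<bar>Re ?z\<bar> * norm ?z ^ 2"
          using Taylor_exp[of ?z 1] by (simp add: algebra_simps numeral_2_eq_2)
        also have "\<dots> \<le> exp (2 * b) * (2 * b * \<bar>h\<bar>)\<^sup>2"
        proof (intro mult_mono power_mono z u)
          have "\<bar>Re ?z\<bar> \<le> 2 * b * \<bar>h\<bar>" using abs_Re_le_cmod z[OF u] order_trans by blast
          also have "\<dots> \<le> 2 * b * 1" using h b0 by (intro mult_left_mono) auto
          finally show "exp \<bar>Re ?z\<bar> \<le> exp (2 * b)" by simp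
        qed auto
        also have "\<dots> = K * h\<^sup>2" by (simp add: K_def power_mult_distrib)
        finally show ?thesis .
      qed
      ultimately show ?thesis
        using W(1)[of x0, OF _ u] W0 by (simp add: norm_mult mult_mono)
    qed
    have hh: "h\<^sup>2 \<le> \<bar>h\<bar>" using mult_left_le[OF h, of "\<bar>h\<bar>"] by (simp add: power2_eq_square)
    have zw: "norm (of_real h * (- 2 * u * w x0 u)) \<le> 2 * b * W * \<bar>h\<bar>" if u: "u \<in> S" for u
    proof -
      have "norm (of_real h * (- 2 * u * w x0 u)) = norm (- 2 * u * of_real h) * norm (w x0 u)"
        by (simp add: norm_mult)
      also have "\<dots> \<le> 2 * b * \<bar>h\<bar> * W"
        using z[OF u] W(1)[of x0, OF _ u] b0 by (intro mult_mono) auto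
      finally show ?thesis by (simp add: mult_ac)
    qed
    have dw: "norm (w x u - w x0 u) \<le> L * \<bar>h\<bar>" if u: "u \<in> S" for u
    proof -
      have "norm (w x u - w x0 u) \<le> norm (R u) + norm (of_real h * (- 2 * u * w x0 u))"
        using norm_triangle_ineq[of "R u" "of_real h * (- 2 * u * w x0 u)"] by (simp add: R_def)
      also have "\<dots> \<le> W * (K * \<bar>h\<bar>) + 2 * b * W * \<bar>h\<bar>"
        using R[OF u] zw[OF u] mult_left_mono[OF mult_left_mono[OF hh K0] W0] by linarith
      finally show ?thesis by (simp add: L_def algebra_simps)
    qed
    have dg: "norm (g x u - g x0 u) \<le> 2 * (L * \<bar>h\<bar> * ((b - a) / a))" if "u \<in> S" for u
      using solution_diff_bound[OF sx s0 _ _ W(2) dw that] W(1) x by auto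
    have gb: "norm (g x u) \<le> 2" "norm (g x0 u) \<le> 2" if "u \<in> S" for u
      using solution_bound[OF sx W(1) W(2) that] solution_bound[OF s0 W(1) W(2) that] x by auto
    \<comment> \<open>First summand: Taylor remainder of the weight. Second: linear term of the
      weight times the change of \<open>g\<close>. Both are of order \<open>h\<close>
      squared.\<close>
    define T where "T u = R u * (g x u * g x0 u) + of_real h * (- 2 * u * w x0 u) * (g x u - g x0 u) * g x0 u" for u
    have "?m x - ?m x0 - of_real h * ?D
        = I (\<lambda>u. (w x u - w x0 u) * g x u * g x0 u - of_real h * (- 2 * u * w x0 u * (g x0 u)\<^sup>2))"
    proof -
      have "I (\<lambda>u. of_real h * (- 2 * u * w x0 u * (g x0 u)\<^sup>2)) = of_real h * ?D"
        using c by (intro I_lmul continuous_intros)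
      moreover have "I (\<lambda>u. (w x u - w x0 u) * g x u * g x0 u - of_real h * (- 2 * u * w x0 u * (g x0 u)\<^sup>2))
          = I (\<lambda>u. (w x u - w x0 u) * g x u * g x0 u) - I (\<lambda>u. of_real h * (- 2 * u * w x0 u * (g x0 u)\<^sup>2))"
        using c by (intro I_diff continuous_intros)
      ultimately show ?thesis by (simp only: moment_diff[OF sx s0])
    qed
    also have "\<dots> = I T"
      by (rule I_cong) (simp add: T_def R_def algebra_simps power2_eq_square)
    finally have eq: "?m x - ?m x0 - of_real h * ?D = I T" .
    have "norm (I T) \<le> Q * h\<^sup>2 * (b - a)"
    proof (rule I_bound)
      show "continuous_on S T" unfolding T_def R_def using c by (intro continuous_intros)
      show "0 \<le> Q * h\<^sup>2" using Q0 by simp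
      fix u assume u: "u \<in> S"
      have "norm (R u * (g x u * g x0 u)) \<le> W * (K * h\<^sup>2) * (2 * 2)"
        unfolding norm_mult using gb[OF u] W0 K0 by (intro mult_mono R u) auto
      moreover have "norm (of_real h * (- 2 * u * w x0 u) * (g x u - g x0 u) * g x0 u)
          \<le> 2 * b * W * \<bar>h\<bar> * (2 * (L * \<bar>h\<bar> * ((b - a) / a))) * 2"
        unfolding norm_mult[of _ "g x0 u"] norm_mult[of _ "g x u - g x0 u"]
        using gb[OF u] W0 L0 a ab b0 by (intro mult_mono zw dg u) auto
      moreover have "2 * b * W * \<bar>h\<bar> * (2 * (L * \<bar>h\<bar> * ((b - a) / a))) * 2
          = 2 * b * W * (2 * (L * ((b - a) / a))) * 2 * (\<bar>h\<bar> * \<bar>h\<bar>)"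
        by (simp only: mult_ac)
      moreover have "\<bar>h\<bar> * \<bar>h\<bar> = h\<^sup>2" by (simp add: power2_eq_square)
      ultimately have "norm (T u) \<le> W * (K * h\<^sup>2) * (2 * 2) + 2 * b * W * (2 * (L * ((b - a) / a))) * 2 * h\<^sup>2"
        unfolding T_def by (metis (no_types, lifting) add_mono norm_triangle_le)
      then show "norm (T u) \<le> Q * h\<^sup>2" unfolding Q_def by (simp only: distrib_right mult.assoc)
    qed
    then show ?thesis unfolding eq[symmetric] h_def by (simp add: mult_ac)
  qed
  show ?thesis
    unfolding has_vector_derivative_def has_derivative_within
  proof (intro conjI bounded_linear_scaleR_left)
    show "((\<lambda>x. (1 / norm (x - x0)) *\<^sub>R (?m x - (?m x0 + (x - x0) *\<^sub>R ?D))) \<longlongrightarrow> 0) (at x0)"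
    proof (rule Lim_null_comparison)
      have "((\<lambda>x. Q * (b - a) * \<bar>x - x0\<bar>) \<longlongrightarrow> Q * (b - a) * \<bar>x0 - x0\<bar>) (at x0)"
        by (intro tendsto_intros)
      then show "((\<lambda>x. Q * (b - a) * \<bar>x - x0\<bar>) \<longlongrightarrow> 0) (at x0)" by simp
      show "\<forall>\<^sub>F x in at x0. norm ((1 / norm (x - x0)) *\<^sub>R (?m x - (?m x0 + (x - x0) *\<^sub>R ?D))) \<le> Q * (b - a) * \<bar>x - x0\<bar>"
        unfolding eventually_at
      proof (intro exI[of _ 1] conjI ballI impI)
        fix x assume x: "x \<noteq> x0 \<and> dist x x0 < 1"
        then have "norm (?m x - ?m x0 - of_real (x - x0) * ?D) \<le> Q * (b - a) * (x - x0)\<^sup>2"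
          by (intro main) (simp add: dist_norm)
        then have "norm (?m x - (?m x0 + (x - x0) *\<^sub>R ?D)) \<le> Q * (b - a) * (\<bar>x - x0\<bar> * \<bar>x - x0\<bar>)"
          by (simp add: scaleR_conv_of_real power2_eq_square diff_diff_eq)
        then show "norm ((1 / norm (x - x0)) *\<^sub>R (?m x - (?m x0 + (x - x0) *\<^sub>R ?D))) \<le> Q * (b - a) * \<bar>x - x0\<bar>"
          using x by (simp add: divide_simps mult_ac)
      qed simp
    qed
  qed
qed

end

subsection \<open>Reduction of the Riemann-Hilbert problem\<close>

lemma of_real_greaterThanLessThan_image:
  fixes a b :: real
  assumes "a < b"
  shows "complex_of_real ` {a<..<b} = open_segment (of_real a) (of_real b)"
proof (rule set_eqI)
  fix z
  have "z \<in> complex_of_real ` {a<..<b} \<longleftrightarrow> Im z = 0 \<and> a < Re z \<and> Re z < b"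
    by (auto intro!: image_eqI[of _ _ "Re z"] simp: complex_eq_iff)
  also have "\<dots> \<longleftrightarrow> z \<in> open_segment (of_real a) (of_real b)"
    unfolding open_segment_def Diff_iff mem_real_closed_segment_iff[OF less_imp_le[OF assms]]
    by (auto simp: complex_eq_iff)
  finally show "z \<in> complex_of_real ` {a<..<b} \<longleftrightarrow> z \<in> open_segment (of_real a) (of_real b)" .
qed

lemma eventually_at_infinity_notin:
  "bounded A \<Longrightarrow> \<forall>\<^sub>F z in at_infinity. z \<notin> A"
  unfolding eventually_at_infinity bounded_iff by (metis linorder_not_less gt_ex order_less_le_trans)

lemma bigo_ln_imp_mult_tendsto_0:
  fixes F :: "complex \<Rightarrow> complex^2"
  assumes "(\<lambda>z. norm (F z)) \<in> O[at e within T](\<lambda>z. ln (norm (z - e)))"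
  shows "((\<lambda>z. (z - e) * F z $ i) \<longlongrightarrow> 0) (at e within T)"
proof -
  obtain c where c: "c > 0" "\<forall>\<^sub>F z in at e within T. norm (norm (F z)) \<le> c * norm (ln (norm (z - e)))"
    using landau_o.bigE[OF assms] by blast
  have "((\<lambda>z. c * \<bar>norm (z - e) * ln (norm (z - e))\<bar>) \<longlongrightarrow> 0) (at e within T)"
    by (intro tendsto_mult_right_zero tendsto_rabs_zero mult_ln_norm_tendsto_0)
  moreover have "\<forall>\<^sub>F z in at e within T. norm ((z - e) * F z $ i) \<le> c * \<bar>norm (z - e) * ln (norm (z - e))\<bar>"
    using c(2)
  proof eventually_elim
    case (elim z)
    have "norm (F z $ i) \<le> c * \<bar>ln (norm (z - e))\<bar>"
      using elim Finite_Cartesian_Product.norm_nth_le[of "F z" i] by simp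
    from mult_left_mono[OF this, of "norm (z - e)"] show ?case
      by (simp add: norm_mult abs_mult mult_ac)
  qed
  ultimately show ?thesis by (rule Lim_null_comparison[rotated])
qed

context segment_equation
begin

definition S' :: "complex set" where
  "S' = closed_segment (of_real (- b)) (of_real (- a))"

lemma mem_S': "z \<in> S' \<longleftrightarrow> Im z = 0 \<and> - b \<le> Re z \<and> Re z \<le> - a"
  unfolding S'_def by (rule mem_real_closed_segment_iff) (use ab in simp)

lemma uminus_mem_S [simp]: "- z \<in> S \<longleftrightarrow> z \<in> S'" "- z \<in> S' \<longleftrightarrow> z \<in> S"
  by (auto simp: mem_S mem_S')

lemma disjoint_S: "z \<in> S \<Longrightarrow> z \<notin> S'"
  using a by (auto simp: mem_S mem_S')

lemma closed_S [simp]: "closed S" "closed S'" by (auto simp: S_def S'_def)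

lemma contour_eq: "contour a b = S \<union> S'"
proof -
  have "closure (Sigma1 a b) = S"
    unfolding Sigma1_def S_def of_real_greaterThanLessThan_image[OF ab]
    by (rule closure_open_segment[THEN trans]) (use ab in simp)
  moreover have "closure (Sigma2 a b) = S'"
  proof -
    have "- b < - a" using ab by simp
    from of_real_greaterThanLessThan_image[OF this] show ?thesis
      unfolding Sigma2_def S'_def by (metis ab closure_open_segment less_irrefl neg_equal_iff_equal of_real_eq_iff)
  qed
  ultimately show ?thesis by simp
qed

text \<open>The factor \<open>1 / (2 * pi)\<close> is what remains of the \<open>- \<i>\<close> in
  the jump and the \<open>2 * pi * \<i>\<close> of the Plemelj formula; for \<open>r\<close> real on
  \<open>S\<close> the weight is real there.\<close>

definition weight :: "(complex \<Rightarrow> complex) \<Rightarrow> real \<Rightarrow> real \<Rightarrow> complex \<Rightarrow> complex" where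
  "weight r t x u = r u * exp (8 * u ^ 3 * of_real t - 2 * u * of_real x) / (2 * pi)"

text \<open>\<open>jump2\<close> fixes the first component, so it continues across
  \<open>S'\<close>; \<open>jump1\<close> adds to it a multiple of the second component, which is
  the reflected first component and hence regular near \<open>S\<close>. One scalar function with a
  single jump segment remains.\<close>

lemma RHP_imp_integral_equation:
  fixes Y :: "complex \<Rightarrow> complex^2"
  assumes r: "admissible_reflection a b r" and Y: "soliton_gas_RHP a b r x t Y"
  obtains g where "solves (weight r t x) g"
    "Lim at_infinity (\<lambda>z. z * (Y z $ 1 - 1)) = I (\<lambda>u. weight r t x u * g u)"
proof -
  let ?w = "weight r t x"
  have hol: "(\<lambda>z. Y z $ 1) holomorphic_on - (S \<union> S')"
    and log: "\<And>e. e \<in> {a, b, - a, - b} \<Longrightarrow>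
      (\<lambda>z. norm (Y z)) \<in> O[at (of_real e) within - (S \<union> S')](\<lambda>z. ln (norm (z - of_real e)))"
    and j1: "\<And>z. z \<in> Sigma1 a b \<Longrightarrow> has_jump_at Y (jump1 r x t z) z"
    and j2: "\<And>z. z \<in> Sigma2 a b \<Longrightarrow> has_jump_at Y (jump2 r x t z) z"
    and inf: "(\<lambda>z. norm (Y z - vector [1, 1])) \<in> O[at_infinity](\<lambda>z. 1 / norm z)"
    and sym: "\<And>z. z \<notin> S \<union> S' \<Longrightarrow> Y (- z) = Y z v* vector [vector [0, 1], vector [1, 0]]"
    using Y unfolding soliton_gas_RHP_def contour_eq by auto
  have sym2: "Y z $ 2 = Y (- z) $ 1" if "z \<notin> S \<union> S'" for z
    using sym[OF that] by (simp add: vector_matrix_mult_def sum_2)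
  \<comment> \<open>The growth conditions refer to the complement of the whole contour. Near an
    endpoint of one segment the other is absent, so the filters coincide.\<close>
  have at_S': "at (complex_of_real e) within - S' = at (of_real e) within - (S \<union> S')"
    if "e = - b \<or> e = - a" for e
  proof (rule at_within_nhd)
    have "of_real e \<in> S'" using that ab by (auto simp: mem_S')
    then show "of_real e \<in> - S" using disjoint_S by blast
  qed auto
  have at_S: "at (complex_of_real e) within - S = at (of_real e) within - (S \<union> S')"
    if "e = a \<or> e = b" for e
  proof (rule at_within_nhd)
    have "of_real e \<in> S" using that ab by (auto simp: mem_S)
    then show "of_real e \<in> - S'" using disjoint_S by blast
  qed auto
  obtain f where f: "f holomorphic_on - S" "\<And>z. z \<in> - S - S' \<Longrightarrow> f z = Y z $ 1"
  proof (rule holomorphic_extend_real_segment[of "- b" "- a" "- S" "\<lambda>z. Y z $ 1", folded S'_def])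
    show "(\<lambda>z. Y z $ 1) holomorphic_on - S - S'"
      using hol by (rule holomorphic_on_subset) auto
    show "\<exists>l. ((\<lambda>z. Y z $ 1) \<longlongrightarrow> l) (at (of_real s) within {w. Im w > 0}) \<and>
        ((\<lambda>z. Y z $ 1) \<longlongrightarrow> l) (at (of_real s) within {w. Im w < 0})" if "- b < s" "s < - a" for s
    proof -
      have "complex_of_real s \<in> Sigma2 a b" using that by (auto simp: Sigma2_def)
      from j2[OF this] obtain Yp Ym where lim: "(Y \<longlongrightarrow> Yp) (at (of_real s) within {w. Im w > 0})"
        "(Y \<longlongrightarrow> Ym) (at (of_real s) within {w. Im w < 0})" and J: "Yp = Ym v* jump2 r x t (of_real s)"
        unfolding has_jump_at_def by blast
      have "Yp $ 1 = Ym $ 1" unfolding J by (simp add: vector_matrix_mult_def sum_2 jump2_def)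
      then show ?thesis using tendsto_vec_nth[OF lim(1), of 1] tendsto_vec_nth[OF lim(2), of 1] by auto
    qed
    show "((\<lambda>z. (z - of_real e) * Y z $ 1) \<longlongrightarrow> 0) (at (of_real e) within - S')" if "e = - b \<or> e = - a" for e
      unfolding at_S'[OF that] using that by (intro bigo_ln_imp_mult_tendsto_0 log) auto
  qed (use ab disjoint_S in auto)
  define g where "g s = f (- s)" for s
  have holg: "g holomorphic_on - S'"
  proof -
    have "f \<circ> uminus holomorphic_on - S'"
    proof (rule holomorphic_on_compose_gen[OF _ f(1)])
      show "uminus holomorphic_on - S'"
        using holomorphic_on_minus[OF holomorphic_on_ident] by simp
      show "uminus ` (- S') \<subseteq> - S" by auto
    qed
    then show ?thesis by (simp add: g_def[abs_def] o_def)
  qed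
  \<comment> \<open>The additive jump of the first component, with the lower boundary value of the
    second already replaced by \<open>g\<close>. It is holomorphic on
    \<open>N \<inter> - S'\<close>, an open set containing \<open>S\<close>.\<close>
  define \<rho> where "\<rho> z = - \<i> * r z * exp (8 * z ^ 3 * of_real t - 2 * z * of_real x) * g z" for z
  obtain N where N: "open N" "S \<union> S' \<subseteq> N" "r holomorphic_on N"
    using r unfolding admissible_reflection_def contour_eq analytic_on_holomorphic by blast
  have hol\<rho>: "\<rho> holomorphic_on N \<inter> - S'"
    unfolding \<rho>_def using N(3) holg
    by (intro holomorphic_intros) (auto elim: holomorphic_on_subset)
  have half: "z \<notin> S \<union> S'" if "Im z \<noteq> 0" for z using that by (auto simp: mem_S mem_S')
  have ev_out: "\<forall>\<^sub>F z in at_infinity. z \<notin> S \<union> S'"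
    by (rule eventually_at_infinity_notin) (simp add: S_def S'_def bounded_closed_segment)
  have f_inf: "(f \<longlongrightarrow> 1) at_infinity"
  proof -
    obtain c where c: "c > 0"
      "\<forall>\<^sub>F z in at_infinity. norm (norm (Y z - vector [1, 1])) \<le> c * norm (1 / norm z)"
      using landau_o.bigE[OF inf] by blast
    have "((\<lambda>z::complex. c * (1 / norm z)) \<longlongrightarrow> 0) at_infinity"
      by (intro tendsto_mult_right_zero tendsto_divide_0[OF tendsto_const] filterlim_at_top_imp_at_infinity filterlim_norm_at_top)
    moreover have "\<forall>\<^sub>F z in at_infinity. norm (f z - 1) \<le> c * (1 / norm z)"
      using c(2) ev_out
    proof eventually_elim
      case (elim z)
      have "norm ((Y z - vector [1, 1]) $ 1) \<le> norm (Y z - vector [1, 1])" by (rule Finite_Cartesian_Product.norm_nth_le)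
      then show ?case using elim f(2)[of z] by simp
    qed
    ultimately have "((\<lambda>z. f z - 1) \<longlongrightarrow> 0) at_infinity" by (rule Lim_null_comparison[rotated])
    then show ?thesis by (simp add: LIM_zero_cancel)
  qed
  have rep: "f z = 1 + I (\<lambda>u. \<rho> u / (u - z)) / (2 * pi * \<i>)" if "z \<notin> S" for z
    unfolding I_def
  proof (rule Plemelj_representation[of a b "N \<inter> - S'" \<rho> f, folded S_def])
    show "\<exists>fp fm. (f \<longlongrightarrow> fp) (at (of_real s) within {w. Im w > 0}) \<and>
       (f \<longlongrightarrow> fm) (at (of_real s) within {w. Im w < 0}) \<and> fp - fm = \<rho> (of_real s)" if s: "a < s" "s < b" for s
    proof -
      let ?U = "at (complex_of_real s) within {w. Im w > 0}"
      let ?L = "at (complex_of_real s) within {w. Im w < 0}"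
      have s1: "complex_of_real s \<in> Sigma1 a b" using s by (auto simp: Sigma1_def)
      from j1[OF this] obtain Yp Ym where lim: "(Y \<longlongrightarrow> Yp) ?U" "(Y \<longlongrightarrow> Ym) ?L"
        and J: "Yp = Ym v* jump1 r x t (of_real s)"
        unfolding has_jump_at_def by blast
      have U: "(f \<longlongrightarrow> Yp $ 1) ?U"
        using tendsto_vec_nth[OF lim(1), of 1]
        by (rule Lim_transform_within[where d = 1]) (use half f(2) in auto)
      have L: "(f \<longlongrightarrow> Ym $ 1) ?L"
        using tendsto_vec_nth[OF lim(2), of 1]
        by (rule Lim_transform_within[where d = 1]) (use half f(2) in auto)
      have "of_real s \<in> - S'" using s a by (auto simp: mem_S')
      then have "isCont g (of_real s)"
        using holg holomorphic_on_imp_continuous_on continuous_on_eq_continuous_at[of "- S'" g]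
        by (simp add: open_Compl)
      then have "(g \<longlongrightarrow> g (of_real s)) ?L"
        unfolding isCont_def by (auto elim: tendsto_within_subset)
      moreover have "(g \<longlongrightarrow> Ym $ 2) ?L"
        using tendsto_vec_nth[OF lim(2), of 2]
      proof (rule Lim_transform_within[where d = 1])
        show "Y z $ 2 = g z" if "z \<in> {w. Im w < 0}" for z
          using that half[of z] half[of "- z"] f(2)[of "- z"] sym2[of z] by (simp add: g_def)
      qed simp
      \<comment> \<open>The lower limit of the second component is an actual value of
        \<open>g\<close>, since \<open>g\<close> is continuous at points of \<open>S\<close>; limits
        within a half plane are unique.\<close>
      ultimately have g2: "Ym $ 2 = g (of_real s)"
        using tendsto_unique at_within_half_plane_neq_bot(2) by blast
      have "Yp $ 1 - Ym $ 1 = \<rho> (of_real s)"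
        unfolding J by (simp add: vector_matrix_mult_def sum_2 jump1_def \<rho>_def g2)
      with U L show ?thesis by blast
    qed
    show "((\<lambda>z. (z - of_real e) * f z) \<longlongrightarrow> 0) (at (of_real e) within - S)" if "e = a \<or> e = b" for e
      unfolding at_S[OF that]
    proof (rule Lim_transform_within[where d = 1])
      show "((\<lambda>z. (z - of_real e) * Y z $ 1) \<longlongrightarrow> 0) (at (of_real e) within - (S \<union> S'))"
        using that by (intro bigo_ln_imp_mult_tendsto_0 log) auto
    qed (use f(2) in auto)
  qed (use ab N disjoint_S f hol\<rho> f_inf that in \<open>auto simp: open_Int open_Compl\<close>)
  have cont\<rho>: "continuous_on S \<rho>"
    using hol\<rho> N(2) disjoint_S by (intro holomorphic_on_imp_continuous_on[OF holomorphic_on_subset]) auto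
  have cw: "continuous_on S ?w"
    unfolding weight_def using N
    by (intro continuous_intros holomorphic_on_imp_continuous_on) (auto elim: holomorphic_on_subset)
  have cg: "continuous_on S g"
    using holg disjoint_S by (intro holomorphic_on_imp_continuous_on[OF holomorphic_on_subset]) auto
  have \<rho>: "\<rho> u = - (2 * pi * \<i>) * (?w u * g u)" for u
    by (simp add: \<rho>_def weight_def)
  show ?thesis
  proof
    show "solves ?w g" unfolding solves_def
    proof (intro conjI ballI cw cg)
      fix s assume s: "s \<in> S"
      \<comment> \<open>The representation is evaluated at \<open>- s\<close>, a point of the left
        segment, where the values of \<open>Y\<close> itself are unconstrained and only the
        extension \<open>f\<close> carries information.\<close>
      then have "- s \<notin> S" using disjoint_S by (metis uminus_mem_S(1))
      from rep[OF this] have "g s = 1 + I (\<lambda>u. - (2 * pi * \<i>) * (?w u * g u / (u + s))) / (2 * pi * \<i>)"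
        by (simp add: g_def \<rho>)
      also have "I (\<lambda>u. - (2 * pi * \<i>) * (?w u * g u / (u + s))) = - (2 * pi * \<i>) * I (\<lambda>u. ?w u * g u / (u + s))"
        using cw cg s by (intro I_lmul continuous_on_kernel continuous_intros)
      finally show "g s = 1 - I (\<lambda>u. ?w u * g u / (u + s))" by simp
    qed
    have "((\<lambda>z. z * I (\<lambda>u. \<rho> u / (u - z)) / (2 * pi * \<i>)) \<longlongrightarrow> - I \<rho> / (2 * pi * \<i>)) at_infinity"
      unfolding I_def
      by (intro tendsto_divide Cauchy_integral_linepath_moment tendsto_const) (use cont\<rho> in \<open>auto simp: S_def\<close>)
    moreover have "\<forall>\<^sub>F z in at_infinity. z * I (\<lambda>u. \<rho> u / (u - z)) / (2 * pi * \<i>) = z * (Y z $ 1 - 1)"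
      using ev_out
    proof eventually_elim
      case (elim z)
      then have "Y z $ 1 = 1 + I (\<lambda>u. \<rho> u / (u - z)) / (2 * pi * \<i>)" using rep[of z] f(2)[of z] by simp
      then show ?case by simp
    qed
    ultimately have lim: "((\<lambda>z. z * (Y z $ 1 - 1)) \<longlongrightarrow> - I \<rho> / (2 * pi * \<i>)) at_infinity"
      by (rule Lim_transform_eventually)
    have "I \<rho> = I (\<lambda>u. - (2 * pi * \<i>) * (?w u * g u))" by (simp add: \<rho>[abs_def])
    also have "\<dots> = - (2 * pi * \<i>) * I (\<lambda>u. ?w u * g u)"
      using cw cg by (intro I_lmul continuous_intros)
    finally have "- I \<rho> / (2 * pi * \<i>) = I (\<lambda>u. ?w u * g u)" by simp
    with lim show "Lim at_infinity (\<lambda>z. z * (Y z $ 1 - 1)) = I (\<lambda>u. ?w u * g u)"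
      by (intro tendsto_Lim) (auto simp: trivial_limit_at_infinity)
  qed
qed

text \<open>For real \<open>v\<close> in \<open>[a, b]\<close> the exponent equals
  \<open>- 8 * v * (\<xi> - v^2) * t + 2 * v * (4 * \<xi> * t - x)\<close>. The first term is
  largest when \<open>v\<close> is replaced by \<open>a\<close> in the outer factor and by
  \<open>b\<close> inside the bracket; the second is at most \<open>2 * b\<close> on the unit
  window.\<close>

lemma norm_weight_le:
  assumes "\<And>u. u \<in> S \<Longrightarrow> norm (r u) \<le> B" and u: "u \<in> S" and t: "0 \<le> t" and x: "\<bar>x - 4 * \<xi> * t\<bar> \<le> 1"
    and \<xi>: "b\<^sup>2 < \<xi>"
  shows "norm (weight r t x u) \<le> B * exp (2 * b) * exp (- (8 * a * (\<xi> - b\<^sup>2)) * t)"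
proof -
  define v where "v = Re u"
  have v: "u = of_real v" "a \<le> v" "v \<le> b" using u by (auto simp: mem_S v_def complex_eq_iff)
  have "2 * (v * (4 * \<xi> * t - x)) \<le> 2 * (b * 1)"
  proof -
    have "v * (4 * \<xi> * t - x) \<le> v * 1" using x v a by (intro mult_left_mono) auto
    then show ?thesis using v by simp
  qed
  moreover have "8 * a * (\<xi> - b\<^sup>2) * t \<le> 8 * v * (\<xi> - v\<^sup>2) * t"
    using v a \<xi> t by (intro mult_right_mono mult_mono) (auto intro: power_mono)
  ultimately have "8 * v ^ 3 * t - 2 * v * x \<le> 2 * b + - (8 * a * (\<xi> - b\<^sup>2)) * t"
    by (simp add: algebra_simps power2_eq_square power3_eq_cube)
  then have E: "exp (8 * v ^ 3 * t - 2 * v * x) \<le> exp (2 * b) * exp (- (8 * a * (\<xi> - b\<^sup>2)) * t)"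
    by (simp add: exp_add[symmetric])
  have B0: "0 \<le> B" using assms(1)[OF u] norm_ge_zero order_trans by blast
  have "norm (weight r t x u) = norm (r u) * exp (8 * v ^ 3 * t - 2 * v * x) / (2 * pi)"
    unfolding weight_def norm_divide norm_mult norm_exp_eq_Re v(1) by simp
  also have "\<dots> \<le> norm (r u) * exp (8 * v ^ 3 * t - 2 * v * x)"
    using pi_ge_two mult_left_mono[of 1 "2 * pi" "norm (r u) * exp (8 * v ^ 3 * t - 2 * v * x)"]
    by (intro mult_imp_div_pos_le) auto
  also have "\<dots> \<le> B * (exp (2 * b) * exp (- (8 * a * (\<xi> - b\<^sup>2)) * t))"
    using E assms(1)[OF u] B0 by (intro mult_mono) auto
  finally show ?thesis by (simp add: mult.assoc)
qed

end

section \<open>Exponential decay of the soliton gas ahead of the front\<close>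

theorem mainTheorem4:
  fixes \<eta>1 \<eta>2 :: real
    and r :: "complex \<Rightarrow> complex"
    and Y :: "real \<Rightarrow> real \<Rightarrow> complex \<Rightarrow> complex^2"
  assumes "0 < \<eta>1" and "\<eta>1 < \<eta>2"
    and "admissible_reflection \<eta>1 \<eta>2 r"
    and "\<And>x t. t \<ge> 0 \<Longrightarrow> soliton_gas_RHP \<eta>1 \<eta>2 r x t (Y x t)"
  shows "\<forall>\<xi> > \<eta>2\<^sup>2. \<exists>C > 0.
           (\<lambda>t. soliton_gas Y (4 * \<xi> * t) t) \<in> O[at_top](\<lambda>t. complex_of_real (exp (- C * t)))"
proof (intro allI impI)
  fix \<xi> :: real assume \<xi>: "\<eta>2\<^sup>2 < \<xi>"
  interpret segment_equation \<eta>1 \<eta>2 using assms by unfold_locales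
  \<comment> \<open>The decay rate of the weight in \<open>norm_weight_le\<close>. It is inherited
    unchanged because the derivative formula contains the weight to the first power, next to the
    bounded factor \<open>g\<close> squared.\<close>
  define C where "C = 8 * \<eta>1 * (\<xi> - \<eta>2\<^sup>2)"
  have C: "C > 0" using assms \<xi> by (simp add: C_def)
  have "r analytic_on S"
    using assms(3) unfolding admissible_reflection_def contour_eq by (blast intro: analytic_on_subset)
  then have "continuous_on S r"
    using analytic_imp_holomorphic holomorphic_on_imp_continuous_on by blast
  then have "bounded (r ` S)"
    unfolding S_def using compact_continuous_image compact_imp_bounded compact_segment by blast
  then obtain B where B: "\<And>u. u \<in> S \<Longrightarrow> norm (r u) \<le> B" unfolding bounded_iff by blast
  define W where "W t = B * exp (2 * \<eta>2) * exp (- C * t)" for t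
  have W: "norm (weight r t x u) \<le> W t" if "0 \<le> t" "\<bar>x - 4 * \<xi> * t\<bar> \<le> 1" "u \<in> S" for t x u
    using norm_weight_le[OF B that(3,1,2) \<xi>] by (simp add: W_def C_def)
  have "((\<lambda>t. W t * ((\<eta>2 - \<eta>1) / (2 * \<eta>1))) \<longlongrightarrow> 0) at_top"
    unfolding W_def using C by real_asymp
  then have small: "\<forall>\<^sub>F t in at_top. W t * ((\<eta>2 - \<eta>1) / (2 * \<eta>1)) < 1 / 2"
    by (rule order_tendstoD) simp
  \<comment> \<open>The outer 2 comes from the definition of the solution. Inside,
    \<open>2 * \<eta>2\<close> bounds \<open>2 * u\<close>, the bracket with \<open>B\<close> is
    \<open>W t\<close> stripped of its decay, 4 bounds the square of \<open>g\<close>, and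
    \<open>\<eta>2 - \<eta>1\<close> is the length of the segment.\<close>
  define K where "K = 2 * (2 * \<eta>2 * (B * exp (2 * \<eta>2)) * 4 * (\<eta>2 - \<eta>1))"
  have "\<forall>\<^sub>F t in at_top. norm (soliton_gas Y (4 * \<xi> * t) t) \<le> K * norm (complex_of_real (exp (- C * t)))"
    using small eventually_ge_at_top[of 0]
  proof eventually_elim
    case (elim t)
    define x0 where "x0 = 4 * \<xi> * t"
    \<comment> \<open>A solution is chosen for every \<open>x\<close> at the same \<open>t\<close>,
      since the derivative in \<open>x\<close> involves neighbouring problems. No relation between
      these choices is presupposed; \<open>moment_has_vector_derivative\<close> supplies it.\<close>
    have "\<exists>g. solves (weight r t x) g \<and>
        Lim at_infinity (\<lambda>z. z * (Y x t z $ 1 - 1)) = I (\<lambda>u. weight r t x u * g u)" for x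
      using RHP_imp_integral_equation[OF assms(3) assms(4)[OF elim(2), of x]] by blast
    then obtain g where g: "\<And>x. solves (weight r t x) (g x)"
      "\<And>x. Lim at_infinity (\<lambda>z. z * (Y x t z $ 1 - 1)) = I (\<lambda>u. weight r t x u * g x u)"
      by metis
    have W2: "W t * ((\<eta>2 - \<eta>1) / (2 * \<eta>1)) \<le> 1 / 2" using elim by simp
    have Wx: "norm (weight r t x u) \<le> W t" if "\<bar>x - x0\<bar> \<le> 1" "u \<in> S" for x u
      using W[OF elim(2)] that by (simp add: x0_def)
    let ?D = "I (\<lambda>u. - 2 * u * weight r t x0 u * (g x0 u)\<^sup>2)"
    have "((\<lambda>x. I (\<lambda>u. weight r t x u * g x u)) has_vector_derivative ?D) (at x0)"
    proof (rule moment_has_vector_derivative[OF g(1) Wx W2])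
      show "weight r t x u = weight r t x0 u * exp (- 2 * u * of_real (x - x0))" for x u
        unfolding weight_def by (simp add: exp_add[symmetric] algebra_simps)
    qed
    then have sg: "soliton_gas Y x0 t = 2 * ?D"
      unfolding soliton_gas_def g(2) by (simp add: vector_derivative_at)
    have c: "continuous_on S (weight r t x0)" "continuous_on S (g x0)"
      using g(1)[of x0] by (auto simp: solves_def)
    have "norm (weight r t x0 (of_real \<eta>1)) \<le> W t" by (rule Wx) (use assms(2) in \<open>auto simp: mem_S\<close>)
    then have W0: "0 \<le> W t" using norm_ge_zero order_trans by blast
    have "norm ?D \<le> 2 * \<eta>2 * W t * 4 * (\<eta>2 - \<eta>1)"
    proof (rule I_bound)
      fix u assume u: "u \<in> S"
      have "norm (g x0 u) \<le> 2" by (rule solution_bound[OF g(1) Wx W2 u]) auto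
      then have "norm (g x0 u) ^ 2 \<le> 2 ^ 2" by (intro power_mono) auto
      then show "norm (- 2 * u * weight r t x0 u * (g x0 u)\<^sup>2) \<le> 2 * \<eta>2 * W t * 4"
        unfolding norm_mult norm_power using norm_S[OF u] Wx[of x0 u] u W0 assms(1,2)
        by (intro mult_mono) auto
    qed (use c W0 assms(1,2) in \<open>auto intro!: continuous_intros\<close>)
    then show ?case
      unfolding x0_def[symmetric] sg by (simp add: norm_mult K_def W_def mult_ac)
  qed
  then have "(\<lambda>t. soliton_gas Y (4 * \<xi> * t) t) \<in> O[at_top](\<lambda>t. complex_of_real (exp (- C * t)))"
    by (rule bigoI)
  with C show "\<exists>C > 0. (\<lambda>t. soliton_gas Y (4 * \<xi> * t) t) \<in> O[at_top](\<lambda>t. complex_of_real (exp (- C * t)))"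
    by blast
qed

end
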